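(* Let $q$ be a complex number with $0<|q|<1$. (1) Let $(A_m)_{m\ge 0}$, $(B_m)_{m\ge 0}$, $(C_m)_{m\ge 0}$ be the sequences each satisfying, for $m\ge 3$, the recursion $$X_m=-(1+q^{2m-4})X_{m-1}+q^2X_{m-2}+q^2X_{m-3}\qquad (X=A,B,C),$$ with initial values $$A_0=-q,\ A_1=q,\ A_2=-q;\qquad B_0=0,\ B_1=0,\ B_2=q;\qquad C_0=1,\ C_1=0,\ C_2=0.$$ Then for every integer $m\ge 0$, $$\sum_{n=0}^{\infty}\frac{q^{2n^2+2mn}}{(q^2;q^2)_{n}(-q;q)_{2n+1}}=\frac{q^{-m}(q,q^6,q^7;q^7)_{\infty}}{(q^2;q^2)_{\infty}}A_m+\frac{q^{-m}(q^2,q^5,q^7;q^7)_{\infty}}{(q^2;q^2)_{\infty}}B_m+\frac{q^{-m}(q^3,q^4,q^7;q^7)_{\infty}}{(q^2;q^2)_{\infty}}C_m.$$ (2) Let $(E_m)_{m\ge 0}$, $(F_m)_{m\ge 0}$, $(G_m)_{m\ge 0}$ be the sequences each satisfying, for $m\ge 3$, the recursion $$X_m=-(q+q^{2m-3})X_{m-1}+X_{m-2}+qX_{m-3}\qquad (X=E,F,G),$$ with initial values $$E_0=0,\ E_1=0,\ E_2=q;\qquad F_0=0,\ F_1=1,\ F_2=-q;\qquad G_0=1,\ G_1=0,\ G_2=1.$$ Then for every integer $m\ge 0$, $$\sum_{n=0}^{\infty}\frac{q^{2n^2+2mn}}{(q^2;q^2)_{n}(-q;q)_{2n}}=\frac{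(q,q^6,q^7;q^7)_{\infty}}{(q^2;q^2)_{\infty}}E_m+\frac{(q^2,q^5,q^7;q^7)_{\infty}}{(q^2;q^2)_{\infty}}F_m+\frac{(q^3,q^4,q^7;q^7)_{\infty}}{(q^2;q^2)_{\infty}}G_m.$$
   Context: For $|p|<1$, $(a;p)_\infty=\prod_{k=0}^{\infty}(1-ap^k)$ and, for an integer $n\ge 0$, $(a;p)_n=\prod_{k=0}^{n-1}(1-ap^k)$. Multiple $q$-shifted factorials are products: $(a_1,\dots,a_r;p)_\infty=(a_1;p)_\infty\cdots(a_r;p)_\infty$. *)

theory Defs
  imports "HOL-Analysis.Analysis"
begin

definition qpoch :: "complex \<Rightarrow> complex \<Rightarrow> nat \<Rightarrow> complex" where
  "qpoch a p n = (\<Prod>k<n. 1 - a * p ^ k)"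

(* Meaningful for norm p < 1, where the product converges in the sense of has_prod,
   which allows finitely many zero factors (giving the value 0). *)
definition qpoch_inf :: "complex \<Rightarrow> complex \<Rightarrow> complex" where
  "qpoch_inf a p = (\<Prod>k. 1 - a * p ^ k)"

definition qpochs_inf :: "complex list \<Rightarrow> complex \<Rightarrow> complex" where
  "qpochs_inf as p = (\<Prod>a\<leftarrow>as. qpoch_inf a p)"

end

theory Submission
  imports Defs
begin

text \<open>
  With $Q = q^2$ and $g_r = (-1)^r q^{r(3r+1)/2}$, the sums
  $\sum_r g_r / ((Q;Q)_{n-r} (Q;Q)_{n+r})$ and $\sum_r g_{\pm r} / ((Q;Q)_{n-r} (Q;Q)_{n+1+r})$
  are evaluated by induction through the two q-Pascal rules. These are Bailey pairs; the q-Vandermonde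
  sum passes them through one step of the Bailey chain, and dominated convergence followed by the
  Jacobi triple product yields the three Rogers-Selberg identities modulo 7. Writing $S(m)$ and $T(m)$
  for the left-hand sides of (2) and (1), one has $T(m) + q T(m+1) = S(m)$ and
  $S(m) - S(m+2) = q^{2m+2} T(m+2)$. Eliminating one of the two families gives the stated
  third-order recursions, and the Rogers-Selberg identities are the initial values
  $S(0)$, $S(1)$ and $T(1)$.
\<close>

section \<open>Finite sums by q-Pascal rules\<close>

text \<open>The theta terms have base \<open>q ^ 3\<close>, the factorials base
  \<open>q ^ 2\<close>. Since the bases differ, the index shift after a q-Pascal rule does not stay
  within one family, as it does in \<open>finite_triple_product\<close>: it moves between the
  families \<open>theta_term (q ^ 3) (q ^ k)\<close> with k = 0, 1, 2. Here k = 2 is g_r, k = 1 is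
  g_(-r), and k = 0 changes sign under reflection at 1/2. Two symmetries close the induction: with
  the factorials of n - r and n + r the sums for k = 1 and k = 2 agree, and with those of n + 1 - r
  and n + r the sum for k = 0 is zero. The prescribed initial values are coordinates: in terms of
  the three products they express S(m) and q^m T(m) for m = 0, 1, 2.\<close>

text \<open>Extending $1/(p;p)_i$ by zero to negative $i$ makes the recurrence \<open>rq_minus_1\<close> and
  the two q-Pascal rules valid for all integers, so that sums over all of the integers can be
  shifted and reflected without boundary terms.\<close>

definition rq :: "complex \<Rightarrow> int \<Rightarrow> complex" where
  "rq p i = (if i < 0 then 0 else 1 / qpoch p p (nat i))"

text \<open>The summand of the Jacobi triple product. As r(r-1) is even, \<open>div\<close> divides
  exactly, also for negative r.\<close>

definition theta_term :: "complex \<Rightarrow> complex \<Rightarrow> int \<Rightarrow> complex" where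
  "theta_term p z r = (- z) powi r * p powi (r * (r - 1) div 2)"

lemma qpoch_0 [simp]: "qpoch a p 0 = 1"
  by (simp add: qpoch_def)

lemma qpoch_Suc: "qpoch a p (Suc n) = qpoch a p n * (1 - a * p ^ n)"
  by (simp add: qpoch_def)

lemma power_ne_1:
  fixes p :: complex
  assumes "norm p < 1" "n > 0"
  shows "p ^ n \<noteq> 1"
proof -
  have "norm (p ^ n) < 1 ^ n"
    unfolding norm_power using assms by (intro power_strict_mono) auto
  then show ?thesis by auto
qed

lemma power_int_ne_1:
  fixes p :: complex
  assumes "norm p < 1" "i > 0"
  shows "1 - p powi i \<noteq> 0"
  using power_ne_1[OF assms(1), of "nat i"] assms(2) by (simp add: power_int_def)

lemma qpoch_nz:
  assumes "norm a < 1" "norm p < 1"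
  shows "qpoch a p n \<noteq> 0"
proof -
  have "1 - a * p ^ k \<noteq> 0" for k
  proof
    assume "1 - a * p ^ k = 0"
    then have "norm a * norm p ^ k = 1"
      by (metis norm_mult norm_power norm_one right_minus_eq)
    moreover have "norm a * norm p ^ k \<le> norm a * 1"
      using assms by (intro mult_left_mono power_le_one) auto
    ultimately show False using assms by linarith
  qed
  then show ?thesis by (simp add: qpoch_def)
qed

lemma rq_neg [simp]: "i < 0 \<Longrightarrow> rq p i = 0"
  by (simp add: rq_def)

lemma rq_of_nat: "rq p (int n) = 1 / qpoch p p n"
  by (simp add: rq_def)

lemma rq_0 [simp]: "rq p 0 = 1"
  by (simp add: rq_def)

text \<open>At i = 0 the factor 1 - p^0 is zero, which is what makes the extension by zero
  consistent.\<close>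

lemma rq_minus_1:
  assumes "norm p < 1"
  shows "rq p (i - 1) = (1 - p powi i) * rq p i"
proof (cases "i \<le> 0")
  case True
  then show ?thesis by (cases "i = 0") auto
next
  case False
  define k where "k = nat (i - 1)"
  have i: "i = int (Suc k)" using False by (simp add: k_def)
  have "1 - p * p ^ k \<noteq> 0" "qpoch p p k \<noteq> 0"
    using power_ne_1[OF assms, of "Suc k"] qpoch_nz[OF assms assms] by auto
  moreover have "p powi i = p * p ^ k"
    unfolding i power_int_of_nat by simp
  moreover have "rq p (i - 1) = 1 / qpoch p p k"
    unfolding i by (simp add: rq_def)
  moreover have "rq p i = 1 / (qpoch p p k * (1 - p * p ^ k))"
    unfolding i rq_of_nat qpoch_Suc by simp
  ultimately show ?thesis by simp
qed

text \<open>Split 1 - p^(i+j) as (1 - p^j) + p^j (1 - p^i) and let each bracket lower one index. The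
  sum and the lowered indices are separate variables so that an instance may have them in any
  arithmetically equal form.\<close>

lemma rq_pascal1:
  assumes "norm p < 1" "p \<noteq> 0" "s = i + j" "i' = i - 1" "j' = j - 1"
  shows "(1 - p powi s) * (c * (rq p i * rq p j))
    = c * (rq p i * rq p j') + c * p powi j * (rq p i' * rq p j)"
proof -
  have "p powi s = p powi i * p powi j"
    using assms(2) unfolding assms(3) by (intro power_int_add) simp
  then show ?thesis
    unfolding assms(4,5) rq_minus_1[OF assms(1)] by (simp add: algebra_simps)
qed

text \<open>The other splitting, 1 - p^(i+j) = (1 - p^i) + p^i (1 - p^j).\<close>

lemma rq_pascal2:
  assumes "norm p < 1" "p \<noteq> 0" "s = i + j" "i' = i - 1" "j' = j - 1"
  shows "(1 - p powi s) * (c * (rq p i * rq p j))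
    = c * (rq p i' * rq p j) + c * p powi i * (rq p i * rq p j')"
proof -
  have "p powi s = p powi i * p powi j"
    using assms(2) unfolding assms(3) by (intro power_int_add) simp
  then show ?thesis
    unfolding assms(4,5) rq_minus_1[OF assms(1)] by (simp add: algebra_simps)
qed

lemma has_sum_shift_int:
  fixes f :: "int \<Rightarrow> complex"
  assumes "((\<lambda>r. f (r + k)) has_sum s) UNIV"
  shows "(f has_sum s) UNIV"
proof -
  have "bij_betw (\<lambda>r. r + k) UNIV (UNIV :: int set)"
    by (rule bij_betw_byWitness[where f' = "\<lambda>r. r - k"]) auto
  from has_sum_reindex_bij_betw[OF this, of f s] assms show ?thesis
    by simp
qed

lemma has_sum_minus_int:
  fixes f :: "int \<Rightarrow> complex"
  assumes "((\<lambda>r. f (- r)) has_sum s) UNIV"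
  shows "(f has_sum s) UNIV"
proof -
  have "bij_betw uminus UNIV (UNIV :: int set)"
    by (rule bij_betw_byWitness[where f' = uminus]) auto
  from has_sum_reindex_bij_betw[OF this, of f s] assms show ?thesis
    by simp
qed

lemma has_sum_divide_factor:
  fixes f :: "int \<Rightarrow> complex"
  assumes "((\<lambda>r. c * f r) has_sum s) UNIV" "c \<noteq> 0"
  shows "(f has_sum (s / c)) UNIV"
  using has_sum_cmult_right[OF assms(1), of "1 / c"] assms(2) by simp

lemma theta_term_0 [simp]: "theta_term p z 0 = 1"
  by (simp add: theta_term_def)

lemma theta_term_add_1:
  assumes "p \<noteq> 0" "z \<noteq> 0"
  shows "theta_term p z (r + 1) = - z * p powi r * theta_term p z r"
proof -
  have "(r + 1) * r = r * (r - 1) + r * 2" by (simp add: algebra_simps)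
  then have e: "(r + 1) * r div 2 = r * (r - 1) div 2 + r"
    by simp
  show ?thesis using assms unfolding theta_term_def
    by (simp add: e power_int_add)
qed

text \<open>The symmetry between z and p/z of the triple product, term by term. For p = q^3 it
  exchanges z = q and z = q^2.\<close>

lemma theta_term_minus:
  assumes "p \<noteq> 0" "z \<noteq> 0"
  shows "theta_term p z (- r) = theta_term p (p / z) r"
proof -
  have "(- r) * (- r - 1) = r * (r - 1) + r * 2" by (simp add: algebra_simps)
  then have e: "(- r) * (- r - 1) div 2 = r * (r - 1) div 2 + r"
    by simp
  have "(- z) powi (- r) * p powi r = (- (p / z)) powi r"
    using power_int_divide_distrib[of p "- z" r] by (simp add: power_int_minus divide_inverse mult.commute)
  then show ?thesis using assms unfolding theta_term_def e
    by (simp add: power_int_add mult_ac)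
qed

lemma theta_term_scale: "theta_term p (w * z) r = w powi r * theta_term p z r"
  using power_int_mult_distrib[of w "- z" r] by (simp add: theta_term_def)

lemma summable_finite_support:
  fixes f :: "int \<Rightarrow> complex"
  assumes "\<And>r. r < a \<Longrightarrow> f r = 0" "\<And>r. r > b \<Longrightarrow> f r = 0"
  shows "f summable_on UNIV"
proof -
  have "f summable_on {a..b}" by simp
  also have "f summable_on {a..b} \<longleftrightarrow> f summable_on UNIV"
    by (rule summable_on_cong_neutral) (use assms in auto)
  finally show ?thesis .
qed

section \<open>Finite forms: triple product and q-Vandermonde\<close>

lemma triple_product_odd_step:
  assumes p: "norm p < 1" "p \<noteq> 0" and z: "z \<noteq> 0" and n: "n \<ge> 0"
    and a: "((\<lambda>r. theta_term p z r * (rq p (n - r) * rq p (n + r))) has_sum a) UNIV"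
  shows "((\<lambda>r. theta_term p z r * (rq p (n - r) * rq p (n + 1 + r))) has_sum
     (a * (1 - p powi (n + 1) / z) / (1 - p powi (2 * n + 1)))) UNIV"
proof (rule has_sum_divide_factor)
  show "1 - p powi (2 * n + 1) \<noteq> 0" using power_int_ne_1[OF p(1), of "2 * n + 1"] n by simp
  \<comment> \<open>The second q-Pascal summand is the given summand shifted by one index, up to a
    factor free of r, so no new series appears.\<close>
  have 1: "((\<lambda>r. theta_term p z r * p powi (n + 1 + r) * (rq p (n - r - 1) * rq p (n + 1 + r)))
     has_sum (- (p powi (n + 1) / z) * a)) UNIV"
  proof (rule has_sum_shift_int[where k = "-1"])
    have "theta_term p z (r + - 1) * p powi (n + 1 + (r + - 1)) = - (p powi (n + 1) / z) * theta_term p z r" for r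
      using arg_cong[OF theta_term_add_1[OF p(2) z, of "r - 1"], of "\<lambda>x. - x * p powi (n + 1) / z"] p(2) z
      by (simp add: power_int_add power_int_diff mult_ac)
    then show "((\<lambda>r. theta_term p z (r + - 1) * p powi (n + 1 + (r + - 1)) *
       (rq p (n - (r + - 1) - 1) * rq p (n + 1 + (r + - 1)))) has_sum - (p powi (n + 1) / z) * a) UNIV"
      using has_sum_cmult_right[OF a, of "- (p powi (n + 1) / z)"] by (simp add: mult_ac)
  qed
  have "(1 - p powi (2 * n + 1)) * (theta_term p z r * (rq p (n - r) * rq p (n + 1 + r))) =
     theta_term p z r * (rq p (n - r) * rq p (n + r))
     + theta_term p z r * p powi (n + 1 + r) * (rq p (n - r - 1) * rq p (n + 1 + r))" for r
    by (rule rq_pascal1[OF p]) simp_all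
  note eq = this
  show "((\<lambda>r. (1 - p powi (2 * n + 1)) * (theta_term p z r * (rq p (n - r) * rq p (n + 1 + r))))
    has_sum a * (1 - p powi (n + 1) / z)) UNIV"
    using has_sum_add[OF a 1] unfolding eq by (simp add: right_diff_distrib mult_ac)
qed

lemma triple_product_even_step:
  assumes p: "norm p < 1" "p \<noteq> 0" and z: "z \<noteq> 0" and n: "n \<ge> 0"
    and a: "((\<lambda>r. theta_term p z r * (rq p (n - r) * rq p (n + 1 + r))) has_sum a) UNIV"
  shows "((\<lambda>r. theta_term p z r * (rq p (n + 1 - r) * rq p (n + 1 + r))) has_sum
     (a * (1 - z * p powi n) / (1 - p powi (2 * n + 2)))) UNIV"
proof (rule has_sum_divide_factor)
  show "1 - p powi (2 * n + 2) \<noteq> 0" using power_int_ne_1[OF p(1), of "2 * n + 2"] n by simp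
  have 1: "((\<lambda>r. theta_term p z r * p powi (n + 1 - r) * (rq p (n + 1 - r) * rq p (n + r)))
     has_sum (- (z * p powi n) * a)) UNIV"
  proof (rule has_sum_shift_int[where k = 1])
    have "theta_term p z (r + 1) * p powi (n + 1 - (r + 1)) = - (z * p powi n) * theta_term p z r" for r
      using theta_term_add_1[OF p(2) z, of "r"] p(2) z
      by (simp add: power_int_add power_int_diff field_simps)
    then show "((\<lambda>r. theta_term p z (r + 1) * p powi (n + 1 - (r + 1)) *
       (rq p (n + 1 - (r + 1)) * rq p (n + (r + 1)))) has_sum - (z * p powi n) * a) UNIV"
      using has_sum_cmult_right[OF a, of "- (z * p powi n)"] by (simp add: mult_ac add_ac)
  qed
  have "(1 - p powi (2 * n + 2)) * (theta_term p z r * (rq p (n + 1 - r) * rq p (n + 1 + r))) =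
     theta_term p z r * (rq p (n - r) * rq p (n + 1 + r))
     + theta_term p z r * p powi (n + 1 - r) * (rq p (n + 1 - r) * rq p (n + r))" for r
    by (rule rq_pascal2[OF p]) simp_all
  note eq = this
  show "((\<lambda>r. (1 - p powi (2 * n + 2)) * (theta_term p z r * (rq p (n + 1 - r) * rq p (n + 1 + r))))
    has_sum a * (1 - z * p powi n)) UNIV"
    using has_sum_add[OF a 1] unfolding eq by (simp add: right_diff_distrib mult_ac)
qed

lemma has_sum_single_int:
  fixes f :: "int \<Rightarrow> complex"
  assumes "\<And>r. r \<noteq> 0 \<Longrightarrow> f r = 0"
  shows "(f has_sum f 0) UNIV"
proof -
  have "(f has_sum f 0) {0}" by (rule has_sum_finiteI) auto
  also have "(f has_sum f 0) {0} \<longleftrightarrow> ?thesis"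
    by (rule has_sum_cong_neutral) (use assms in auto)
  finally show ?thesis .
qed

text \<open>Passing from n to n + 1 takes two half-steps, raising one factorial index at a time;
  they contribute the factors 1 - (p/z) p^n and 1 - z p^n.\<close>

lemma finite_triple_product:
  assumes p: "norm p < 1" "p \<noteq> 0" and z: "z \<noteq> 0"
  shows "((\<lambda>r. theta_term p z r * (rq p (int n - r) * rq p (int n + r))) has_sum
     (qpoch z p n * qpoch (p / z) p n / qpoch p p (2 * n))) UNIV"
proof (induction n)
  case 0
  show ?case
    using has_sum_single_int[of "\<lambda>r. theta_term p z r * (rq p (int 0 - r) * rq p (int 0 + r))"]
    by (auto simp: rq_def)
next
  case (Suc n)
  have e: "2 * Suc n = Suc (Suc (2 * n))" by simp
  have "p powi (int n + 1) = p ^ (n + 1)" "p powi (2 * int n + 1) = p ^ (2 * n + 1)"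
     "p powi (2 * int n + 2) = p ^ (2 * n + 2)"
    by (simp_all add: power_int_def nat_add_distrib nat_mult_distrib)
  then have pw: "p powi (int n + 1) / z = p / z * p ^ n" "p powi (2 * int n + 1) = p * p ^ (2 * n)"
     "p powi (2 * int n + 2) = p * p ^ Suc (2 * n)"
    by simp_all
  have "qpoch z p (Suc n) * qpoch (p / z) p (Suc n) / qpoch p p (2 * Suc n) =
    qpoch z p n * qpoch (p / z) p n / qpoch p p (2 * n) * (1 - p powi (int n + 1) / z) /
     (1 - p powi (2 * int n + 1)) * (1 - z * p powi (int n)) / (1 - p powi (2 * int n + 2))"
    unfolding e qpoch_Suc pw power_int_of_nat
    by (simp only: times_divide_eq_left times_divide_eq_right divide_divide_eq_left mult_ac)
  then show ?case
    using triple_product_even_step[OF p z _ triple_product_odd_step[OF p z _ Suc.IH]]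
    by (simp add: add_ac)
qed

text \<open>The induction needs all b at once, because shifting s in the second q-Pascal summand
  replaces b by b + 1. Negative b must be included: the Bailey chain uses b = 2r + d.\<close>

lemma q_vandermonde:
  assumes p: "norm p < 1" "p \<noteq> 0"
  shows "((\<lambda>s. p powi (s * (s + b)) * (rq p (int n - s) * rq p s * rq p (s + b))) has_sum
     (rq p (int n) * rq p (int n + b))) UNIV"
proof (induction n arbitrary: b)
  case 0
  show ?case
    using has_sum_single_int[of "\<lambda>s. p powi (s * (s + b)) * (rq p (int 0 - s) * rq p s * rq p (s + b))"]
    by (auto simp: rq_def)
next
  case (Suc n)
  define A where "A = int (Suc n)"
  have A: "A > 0" "int n = A - 1" "int (Suc n) = A" by (auto simp: A_def)
  have nz: "1 - p powi A \<noteq> 0" using power_int_ne_1[OF p(1)] A by simp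
  have 1: "((\<lambda>s. p powi (s * (s + b)) * p powi (A - s) * (rq p (A - s) * rq p (s - 1) * rq p (s + b)))
     has_sum (p powi (A + b) * (rq p (A - 1) * rq p (A + b)))) UNIV"
  proof (rule has_sum_shift_int[where k = 1])
    have "p powi ((s + 1) * (s + 1 + b)) * p powi (A - (s + 1)) = p powi (A + b) * p powi (s * (s + (b + 1)))" for s
    proof -
      have "(s + 1) * (s + 1 + b) + (A - (s + 1)) = (A + b) + s * (s + (b + 1))"
        by (simp add: algebra_simps)
      then show ?thesis
        by (simp only: power_int_add[OF disjI1[OF p(2)], symmetric])
    qed
    moreover have "A - (s + 1) = A - 1 - s" "s + 1 + b = s + (b + 1)" for s
      by simp_all
    ultimately have "p powi ((s + 1) * (s + 1 + b)) * p powi (A - (s + 1)) *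
       (rq p (A - (s + 1)) * rq p (s + 1 - 1) * rq p (s + 1 + b)) =
       p powi (A + b) * (p powi (s * (s + (b + 1))) *
       (rq p (A - 1 - s) * rq p s * rq p (s + (b + 1))))" for s
      by (simp only: add_diff_cancel_right' mult.assoc)
    moreover have "A - 1 + (b + 1) = A + b" by simp
    ultimately show "((\<lambda>s. p powi ((s + 1) * (s + 1 + b)) * p powi (A - (s + 1)) *
       (rq p (A - (s + 1)) * rq p (s + 1 - 1) * rq p (s + 1 + b))) has_sum
        (p powi (A + b) * (rq p (A - 1) * rq p (A + b)))) UNIV"
      using has_sum_cmult_right[OF Suc.IH[of "b + 1"], of "p powi (A + b)"]
      unfolding A(2) by (simp only:)
  qed
  \<comment> \<open>The indices A - s and s add up to A, so the factor on the left is free of s;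
    \<open>rq p (s + b)\<close> is carried along in the constant.\<close>
  have "(1 - p powi A) * (p powi (s * (s + b)) * (rq p (A - s) * rq p s * rq p (s + b))) =
     p powi (s * (s + b)) * (rq p (A - 1 - s) * rq p s * rq p (s + b)) +
     p powi (s * (s + b)) * p powi (A - s) * (rq p (A - s) * rq p (s - 1) * rq p (s + b))" for s
    using rq_pascal2[OF p, of A "A - s" "s" "A - 1 - s" "s - 1" "p powi (s * (s + b)) * rq p (s + b)"]
    by (simp add: mult_ac)
  then have "((\<lambda>s. (1 - p powi A) * (p powi (s * (s + b)) * (rq p (A - s) * rq p s * rq p (s + b)))) has_sum
     (rq p (A - 1) * rq p (A - 1 + b) + p powi (A + b) * (rq p (A - 1) * rq p (A + b)))) UNIV"
    using has_sum_add[OF Suc.IH[of b] 1] by (simp add: A(2))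
  also have "rq p (A - 1) * rq p (A - 1 + b) + p powi (A + b) * (rq p (A - 1) * rq p (A + b))
     = (1 - p powi A) * (rq p A * rq p (A + b))"
  proof -
    have b: "rq p (A - 1 + b) = (1 - p powi (A + b)) * rq p (A + b)"
      using rq_minus_1[OF p(1), of "A + b"] by (simp add: diff_add_eq)
    show ?thesis unfolding b rq_minus_1[OF p(1), of A] by (simp add: algebra_simps)
  qed
  finally have "((\<lambda>s. (1 - p powi A) * (p powi (s * (s + b)) * (rq p (A - s) * rq p s * rq p (s + b)))) has_sum
     ((1 - p powi A) * (rq p A * rq p (A + b)))) UNIV" .
  from has_sum_divide_factor[OF this nz] show ?case unfolding A(3) using nz by simp
qed

section \<open>The Bailey pairs\<close>

text \<open>Reflection preserves the sum s and negates every term, hence s = - s.\<close>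

lemma has_sum_eq_0_if_antisym:
  fixes f :: "int \<Rightarrow> complex"
  assumes "f summable_on UNIV" and anti: "\<And>r. f (k - r) = - f r"
  shows "(f has_sum 0) UNIV"
proof -
  obtain s where s: "(f has_sum s) UNIV"
    using assms(1) by (auto simp: summable_on_def)
  have "((\<lambda>r. f (- (r + (- k)))) has_sum (- s)) UNIV"
    using has_sum_cmult_right[OF s, of "-1"] anti by simp
  then have "((\<lambda>r. f (- r)) has_sum (- s)) UNIV"
    by (rule has_sum_shift_int)
  then have "(f has_sum (- s)) UNIV"
    by (rule has_sum_minus_int)
  with s have "s = - s" by (rule has_sum_unique)
  with s show ?thesis by simp
qed

lemma theta_term_cube:
  "theta_term (q ^ 3) (q ^ k) r = q powi (int k * r) * theta_term (q ^ 3) 1 r"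
  using theta_term_scale[of "q ^ 3" "q ^ k" 1 r] by (simp add: power_int_power)

context
  fixes q :: complex
  assumes q: "norm q < 1" "q \<noteq> 0"
begin

lemma q2: "norm (q ^ 2) < 1" "q ^ 2 \<noteq> 0"
  using q by (auto simp: norm_power power_less_one_iff)

lemma q2_powi: "(q ^ 2) powi i = q powi (2 * i)"
  by (simp add: power_int_power)

lemma powi_add: "q powi i * q powi j = q powi (i + j)"
  using q by (simp add: power_int_add)

lemma theta_step: "theta_term (q ^ 3) 1 (r + 1) = - (q powi (3 * r) * theta_term (q ^ 3) 1 r)"
  using theta_term_add_1[of "q ^ 3" 1 r] q by (simp add: power_int_power)

text \<open>For z = 1 the exponent 3r(r-1)/2 is invariant under reflection at 1/2, while the sign
  (-1)^r flips.\<close>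

lemma theta_antisym: "theta_term (q ^ 3) 1 (1 - r) = - theta_term (q ^ 3) 1 r"
proof -
  have "theta_term (q ^ 3) 1 (1 - r) = theta_term (q ^ 3) (q ^ 3) (r - 1)"
    using theta_term_minus[of "q ^ 3" 1 "r - 1"] q by simp
  also have "\<dots> = q powi (3 * (r - 1)) * theta_term (q ^ 3) 1 (r - 1)"
    by (simp only: theta_term_cube) simp
  also have "\<dots> = - theta_term (q ^ 3) 1 r"
    using theta_step[of "r - 1"] by simp
  finally show ?thesis .
qed

lemma theta_reflect: "theta_term (q ^ 3) (q ^ 1) (- r) = theta_term (q ^ 3) (q ^ 2) r"
  using theta_term_minus[of "q ^ 3" "q" r] q by (simp add: power2_eq_square power3_eq_cube)

text \<open>Under r to -r the two factorials trade places. This depends on the balanced indices n -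
  r and n + r; with n + 1 + r the two families yield two different Bailey pairs.\<close>

lemma reflected_sum:
  "((\<lambda>r. theta_term (q ^ 3) (q ^ 2) r * (rq (q ^ 2) (n - r) * rq (q ^ 2) (n + r))) has_sum a) UNIV
    \<longleftrightarrow> ((\<lambda>r. theta_term (q ^ 3) (q ^ 1) r * (rq (q ^ 2) (n - r) * rq (q ^ 2) (n + r))) has_sum a) UNIV"
  (is "?A \<longleftrightarrow> ?B")
proof
  assume A: ?A
  show ?B
  proof (rule has_sum_minus_int)
    have "n - - r = n + r" "n + - r = n - r" for r by simp_all
    then have "theta_term (q ^ 3) (q ^ 1) (- r) * (rq (q ^ 2) (n - - r) * rq (q ^ 2) (n + - r))
      = theta_term (q ^ 3) (q ^ 2) r * (rq (q ^ 2) (n - r) * rq (q ^ 2) (n + r))" for r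
      by (simp only: theta_reflect mult.commute)
    with A show "((\<lambda>r. theta_term (q ^ 3) (q ^ 1) (- r) *
        (rq (q ^ 2) (n - - r) * rq (q ^ 2) (n + - r))) has_sum a) UNIV"
      by (simp only:)
  qed
next
  assume B: ?B
  show ?A
  proof (rule has_sum_minus_int)
    have "n - - r = n + r" "n + - r = n - r" for r by simp_all
    moreover have "theta_term (q ^ 3) (q ^ 2) (- r) = theta_term (q ^ 3) (q ^ 1) r" for r
      using theta_reflect[of "- r"] by (simp only: minus_minus)
    ultimately have "theta_term (q ^ 3) (q ^ 2) (- r) * (rq (q ^ 2) (n - - r) * rq (q ^ 2) (n + - r))
      = theta_term (q ^ 3) (q ^ 1) r * (rq (q ^ 2) (n - r) * rq (q ^ 2) (n + r))" for r
      by (simp only: mult.commute)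
    with B show "((\<lambda>r. theta_term (q ^ 3) (q ^ 2) (- r) *
        (rq (q ^ 2) (n - - r) * rq (q ^ 2) (n + - r))) has_sum a) UNIV"
      by (simp only:)
  qed
qed

text \<open>With u = q^(2n+1), the second q-Pascal summand shifts to -u times the g_(-r) sum, which
  is again a by reflection. The quotient (1 - u)/(1 - u^2) leaves 1/(1 + u), a new factor of
  (-q;q).\<close>

lemma bailey_odd_step:
  assumes n: "n \<ge> 0"
    and a: "((\<lambda>r. theta_term (q ^ 3) (q ^ 2) r * (rq (q ^ 2) (n - r) * rq (q ^ 2) (n + r))) has_sum a) UNIV"
  shows "((\<lambda>r. theta_term (q ^ 3) (q ^ 2) r * (rq (q ^ 2) (n - r) * rq (q ^ 2) (n + 1 + r))) has_sum
     (a / (1 + q powi (2 * n + 1)))) UNIV"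
proof -
  let ?R = "rq (q ^ 2)" and ?t = "\<lambda>k. theta_term (q ^ 3) (q ^ k)"
  let ?u = "q powi (2 * n + 1)"
  have u2: "(q ^ 2) powi (2 * n + 1) = ?u ^ 2"
    by (simp add: power_int_power power_int_power' mult.commute)
  have nz: "1 - ?u ^ 2 \<noteq> 0"
    using power_int_ne_1[OF q2(1), of "2 * n + 1"] n unfolding u2 by simp
  note a1 = a[unfolded reflected_sum]
  have 1: "((\<lambda>r. ?t 2 r * (q ^ 2) powi (n + 1 + r) * (?R (n - 1 - r) * ?R (n + 1 + r))) has_sum (- ?u * a)) UNIV"
  proof (rule has_sum_shift_int[where k = "-1"])
    have "?t 2 (r + -1) * (q ^ 2) powi (n + 1 + (r + -1)) = - ?u * ?t 1 r" for r
    proof -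
      have "2 * (r + -1) + 2 * (n + 1 + (r + -1)) = (2 * n + 1) + (r + 3 * (r - 1))" by simp
      then have e: "q powi (2 * (r + -1)) * q powi (2 * (n + 1 + (r + -1))) = ?u * (q powi r * q powi (3 * (r - 1)))"
        unfolding powi_add by (simp only:)
      have "?t 2 (r + -1) * (q ^ 2) powi (n + 1 + (r + -1))
          = (q powi (2 * (r + -1)) * q powi (2 * (n + 1 + (r + -1)))) * theta_term (q ^ 3) 1 (r - 1)"
        unfolding theta_term_cube q2_powi by simp
      also have "\<dots> = ?u * q powi r * (q powi (3 * (r - 1)) * theta_term (q ^ 3) 1 (r - 1))"
        unfolding e by (simp only: mult.assoc)
      also have "q powi (3 * (r - 1)) * theta_term (q ^ 3) 1 (r - 1) = - theta_term (q ^ 3) 1 r"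
        using theta_step[of "r - 1"] by simp
      finally show ?thesis unfolding theta_term_cube by simp
    qed
    moreover have "n - 1 - (r + -1) = n - r" "n + 1 + (r + -1) = n + r" for r by simp_all
    ultimately show "((\<lambda>r. ?t 2 (r + -1) * (q ^ 2) powi (n + 1 + (r + -1)) *
        (?R (n - 1 - (r + -1)) * ?R (n + 1 + (r + -1)))) has_sum (- ?u * a)) UNIV"
      using has_sum_cmult_right[OF a1, of "- ?u"] by (simp only: mult.assoc)
  qed
  have "(1 - (q ^ 2) powi (2 * n + 1)) * (?t 2 r * (?R (n - r) * ?R (n + 1 + r))) =
     ?t 2 r * (?R (n - r) * ?R (n + r)) + ?t 2 r * (q ^ 2) powi (n + 1 + r) * (?R (n - 1 - r) * ?R (n + 1 + r))" for r
    by (rule rq_pascal1[OF q2]) simp_all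
  note eq = this[unfolded u2]
  have "((\<lambda>r. (1 - ?u ^ 2) * (?t 2 r * (?R (n - r) * ?R (n + 1 + r)))) has_sum (a + - ?u * a)) UNIV"
    unfolding eq by (rule has_sum_add[OF a 1])
  from has_sum_divide_factor[OF this nz]
  show ?thesis
  proof (rule back_subst[where P = "\<lambda>s. (_ has_sum s) _"])
    have "1 - ?u ^ 2 = (1 - ?u) * (1 + ?u)" by (simp add: power2_eq_square algebra_simps)
    moreover have "a + - ?u * a = (1 - ?u) * a" by (simp add: algebra_simps)
    moreover have "1 - ?u \<noteq> 0" using calculation(1) nz by auto
    ultimately show "(a + - ?u * a) / (1 - ?u ^ 2) = a / (1 + ?u)" by simp
  qed
qed

text \<open>The summand changes sign under $r \mapsto 1 - r$.\<close>

lemma vanishing_sum: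
  "((\<lambda>r. theta_term (q ^ 3) 1 r * (rq (q ^ 2) (n + 1 - r) * rq (q ^ 2) (n + r))) has_sum 0) UNIV"
proof (rule has_sum_eq_0_if_antisym)
  show "(\<lambda>r. theta_term (q ^ 3) 1 r * (rq (q ^ 2) (n + 1 - r) * rq (q ^ 2) (n + r))) summable_on UNIV"
    by (rule summable_finite_support[of "- n" _ "n + 1"]) auto
  have "n + 1 - (1 - r) = n + r" "n + (1 - r) = n + 1 - r" for r by simp_all
  then show "theta_term (q ^ 3) 1 (1 - r) * (rq (q ^ 2) (n + 1 - (1 - r)) * rq (q ^ 2) (n + (1 - r))) =
    - (theta_term (q ^ 3) 1 r * (rq (q ^ 2) (n + 1 - r) * rq (q ^ 2) (n + r)))" for r
    by (simp only: theta_antisym mult_minus_left mult.commute)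
qed

text \<open>Here the second q-Pascal summand is a multiple of the antisymmetric sum and drops out,
  so only the division remains.\<close>

lemma bailey_even_step:
  assumes n: "n \<ge> 0"
    and a: "((\<lambda>r. theta_term (q ^ 3) (q ^ 2) r * (rq (q ^ 2) (n - r) * rq (q ^ 2) (n + 1 + r))) has_sum a) UNIV"
  shows "((\<lambda>r. theta_term (q ^ 3) (q ^ 2) r * (rq (q ^ 2) (n + 1 - r) * rq (q ^ 2) (n + 1 + r))) has_sum
     (a / (1 - (q ^ 2) powi (2 * n + 2)))) UNIV"
proof (rule has_sum_divide_factor)
  let ?R = "rq (q ^ 2)" and ?t = "\<lambda>k. theta_term (q ^ 3) (q ^ k)"
  show "1 - (q ^ 2) powi (2 * n + 2) \<noteq> 0"
    using power_int_ne_1[OF q2(1), of "2 * n + 2"] n by simp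
  have "?t 2 r * (q ^ 2) powi (n + 1 - r) = q powi (2 * n + 2) * theta_term (q ^ 3) 1 r" for r
  proof -
    have "2 * r + 2 * (n + 1 - r) = 2 * n + 2" by simp
    then have "q powi (2 * r) * q powi (2 * (n + 1 - r)) = q powi (2 * n + 2)"
      unfolding powi_add by (simp only:)
    then show ?thesis unfolding theta_term_cube q2_powi by simp
  qed
  then have 1: "((\<lambda>r. ?t 2 r * (q ^ 2) powi (n + 1 - r) * (?R (n + 1 - r) * ?R (n + r))) has_sum 0) UNIV"
    using has_sum_cmult_right[OF vanishing_sum[of n], of "q powi (2 * n + 2)"]
    by (simp only: mult.assoc mult_zero_right)
  have eq: "(1 - (q ^ 2) powi (2 * n + 2)) * (?t 2 r * (?R (n + 1 - r) * ?R (n + 1 + r))) =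
     ?t 2 r * (?R (n - r) * ?R (n + 1 + r)) + ?t 2 r * (q ^ 2) powi (n + 1 - r) * (?R (n + 1 - r) * ?R (n + r))" for r
    by (rule rq_pascal2[OF q2]) simp_all
  show "((\<lambda>r. (1 - (q ^ 2) powi (2 * n + 2)) * (?t 2 r * (?R (n + 1 - r) * ?R (n + 1 + r)))) has_sum a) UNIV"
    unfolding eq using has_sum_add[OF a 1] by simp
qed

text \<open>A q-Pascal rule applied to \<open>vanishing_sum\<close> splits zero into this sum and
  another one, which a shift and a reflection evaluate to -q^(2n) a. It is the correction term
  needed for \<open>bailey_odd_step_reflected\<close>.\<close>

lemma cross_sum:
  assumes a: "((\<lambda>r. theta_term (q ^ 3) (q ^ 2) r * (rq (q ^ 2) (n - r) * rq (q ^ 2) (n + r))) has_sum a) UNIV"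
  shows "((\<lambda>r. theta_term (q ^ 3) 1 r * (rq (q ^ 2) (n - r) * rq (q ^ 2) (n + r))) has_sum
     (q powi (2 * n) * a)) UNIV"
proof -
  let ?R = "rq (q ^ 2)" and ?t = "\<lambda>k. theta_term (q ^ 3) (q ^ k)" and ?h = "theta_term (q ^ 3) 1"
  note a1 = a[unfolded reflected_sum]
  have 1: "((\<lambda>r. ?h r * (q ^ 2) powi (n + 1 - r) * (?R (n + 1 - r) * ?R (n - 1 + r))) has_sum
     (- (q powi (2 * n)) * a)) UNIV"
  proof (rule has_sum_shift_int[where k = 1])
    have "?h (r + 1) * (q ^ 2) powi (n + 1 - (r + 1)) = - (q powi (2 * n)) * ?t 1 r" for r
    proof -
      have "3 * r + 2 * (n + 1 - (r + 1)) = 2 * n + r" by simp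
      then have "q powi (3 * r) * q powi (2 * (n + 1 - (r + 1))) = q powi (2 * n) * q powi r"
        unfolding powi_add by (simp only:)
      then show ?thesis unfolding theta_term_cube q2_powi theta_step by simp
    qed
    moreover have "n + 1 - (r + 1) = n - r" "n - 1 + (r + 1) = n + r" for r by simp_all
    ultimately show "((\<lambda>r. ?h (r + 1) * (q ^ 2) powi (n + 1 - (r + 1)) *
        (?R (n + 1 - (r + 1)) * ?R (n - 1 + (r + 1)))) has_sum (- (q powi (2 * n)) * a)) UNIV"
      using has_sum_cmult_right[OF a1, of "- (q powi (2 * n))"] by (simp only: mult.assoc)
  qed
  have eq: "(1 - (q ^ 2) powi (2 * n + 1)) * (?h r * (?R (n + 1 - r) * ?R (n + r))) =
     ?h r * (?R (n - r) * ?R (n + r)) + ?h r * (q ^ 2) powi (n + 1 - r) * (?R (n + 1 - r) * ?R (n - 1 + r))" for r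
    by (rule rq_pascal2[OF q2]) simp_all
  have "((\<lambda>r. (1 - (q ^ 2) powi (2 * n + 1)) * (?h r * (?R (n + 1 - r) * ?R (n + r))) +
     (-1) * (?h r * (q ^ 2) powi (n + 1 - r) * (?R (n + 1 - r) * ?R (n - 1 + r)))) has_sum
     ((1 - (q ^ 2) powi (2 * n + 1)) * 0 + (-1) * (- (q powi (2 * n)) * a))) UNIV"
    by (intro has_sum_add has_sum_cmult_right vanishing_sum 1)
  then show ?thesis unfolding eq by simp
qed

text \<open>By \<open>cross_sum\<close> the correction is -q^(4n+2) a. The resulting factor 1 -
  q^(4n+2) is the q-Pascal factor itself, so raising an index leaves the value a unchanged.\<close>

lemma bailey_odd_step_reflected:
  assumes n: "n \<ge> 0"
    and a: "((\<lambda>r. theta_term (q ^ 3) (q ^ 2) r * (rq (q ^ 2) (n - r) * rq (q ^ 2) (n + r))) has_sum a) UNIV"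
  shows "((\<lambda>r. theta_term (q ^ 3) (q ^ 1) r * (rq (q ^ 2) (n - r) * rq (q ^ 2) (n + 1 + r))) has_sum a) UNIV"
proof -
  let ?R = "rq (q ^ 2)" and ?t = "\<lambda>k. theta_term (q ^ 3) (q ^ k)" and ?h = "theta_term (q ^ 3) 1"
  note a1 = a[unfolded reflected_sum]
  have 1: "((\<lambda>r. ?t 1 r * (q ^ 2) powi (n + 1 + r) * (?R (n - 1 - r) * ?R (n + 1 + r))) has_sum
     (- (q powi (2 * n + 2)) * (q powi (2 * n) * a))) UNIV"
  proof (rule has_sum_shift_int[where k = "-1"])
    have "?t 1 (r + -1) * (q ^ 2) powi (n + 1 + (r + -1)) = - (q powi (2 * n + 2)) * ?h r" for r
    proof -
      have "(r + -1) + 2 * (n + 1 + (r + -1)) = (2 * n + 2) + 3 * (r - 1)" by simp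
      then have e: "q powi (r + -1) * q powi (2 * (n + 1 + (r + -1))) = q powi (2 * n + 2) * q powi (3 * (r - 1))"
        unfolding powi_add by (simp only:)
      have "?t 1 (r + -1) * (q ^ 2) powi (n + 1 + (r + -1))
          = (q powi (r + -1) * q powi (2 * (n + 1 + (r + -1)))) * ?h (r - 1)"
        unfolding theta_term_cube q2_powi by simp
      also have "\<dots> = q powi (2 * n + 2) * (q powi (3 * (r - 1)) * ?h (r - 1))"
        unfolding e by (simp only: mult.assoc)
      also have "q powi (3 * (r - 1)) * ?h (r - 1) = - ?h r"
        using theta_step[of "r - 1"] by simp
      finally show ?thesis by simp
    qed
    moreover have "n - 1 - (r + -1) = n - r" "n + 1 + (r + -1) = n + r" for r by simp_all
    ultimately show "((\<lambda>r. ?t 1 (r + -1) * (q ^ 2) powi (n + 1 + (r + -1)) *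
        (?R (n - 1 - (r + -1)) * ?R (n + 1 + (r + -1)))) has_sum
        (- (q powi (2 * n + 2)) * (q powi (2 * n) * a))) UNIV"
      using has_sum_cmult_right[OF cross_sum[OF a], of "- (q powi (2 * n + 2))"]
      by (simp only: mult.assoc)
  qed
  have nz: "1 - (q ^ 2) powi (2 * n + 1) \<noteq> 0"
    using power_int_ne_1[OF q2(1), of "2 * n + 1"] n by simp
  have eq: "(1 - (q ^ 2) powi (2 * n + 1)) * (?t 1 r * (?R (n - r) * ?R (n + 1 + r))) =
     ?t 1 r * (?R (n - r) * ?R (n + r)) + ?t 1 r * (q ^ 2) powi (n + 1 + r) * (?R (n - 1 - r) * ?R (n + 1 + r))" for r
    by (rule rq_pascal1[OF q2]) simp_all
  have "q powi (2 * n + 2) * q powi (2 * n) = (q ^ 2) powi (2 * n + 1)"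
    unfolding powi_add q2_powi by (simp add: algebra_simps)
  then have "a + - (q powi (2 * n + 2)) * (q powi (2 * n) * a) = (1 - (q ^ 2) powi (2 * n + 1)) * a"
    by (simp add: left_diff_distrib flip: mult.assoc)
  then have "((\<lambda>r. (1 - (q ^ 2) powi (2 * n + 1)) * (?t 1 r * (?R (n - r) * ?R (n + 1 + r)))) has_sum
      ((1 - (q ^ 2) powi (2 * n + 1)) * a)) UNIV"
    unfolding eq using has_sum_add[OF a1 1] by (simp only:)
  from has_sum_divide_factor[OF this nz] nz show ?thesis by simp
qed

lemma bailey_pair_even:
  "((\<lambda>r. theta_term (q ^ 3) (q ^ 2) r * (rq (q ^ 2) (int n - r) * rq (q ^ 2) (int n + r))) has_sum
     (1 / (qpoch (q ^ 2) (q ^ 2) n * qpoch (- q) q (2 * n)))) UNIV"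
proof (induction n)
  case 0
  show ?case
    using has_sum_single_int[of "\<lambda>r. theta_term (q ^ 3) (q ^ 2) r * (rq (q ^ 2) (int 0 - r) * rq (q ^ 2) (int 0 + r))"]
    by (auto simp: rq_def)
next
  case (Suc n)
  have e: "2 * Suc n = Suc (Suc (2 * n))" by simp
  have x: "q * q ^ Suc (2 * n) = q ^ 2 * (q ^ 2) ^ n"
    by (simp add: power_mult power2_eq_square)
  have pw: "q powi (2 * int n + 1) = q * q ^ (2 * n)"
     "(q ^ 2) powi (2 * int n + 2) = (q ^ 2) ^ (2 * n + 2)"
    by (simp_all add: power_int_def nat_add_distrib nat_mult_distrib)
  have "(q ^ 2) ^ (2 * n + 2) = (q ^ 2 * (q ^ 2) ^ n) * (q ^ 2 * (q ^ 2) ^ n)"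
    by (simp add: power_add mult_2)
  \<comment> \<open>1 - q^(4n+4) splits into the new last factors of
    \<open>qpoch (q ^ 2) (q ^ 2) (Suc n)\<close> and
    \<open>qpoch (- q) q (2 * Suc n)\<close>.\<close>
  then have f: "1 - (q ^ 2) powi (2 * int n + 2) = (1 - q ^ 2 * (q ^ 2) ^ n) * (1 - - q * q ^ Suc (2 * n))"
    unfolding pw mult_minus_left x by (simp only:) (simp only: algebra_simps, simp)
  have "1 / (qpoch (q ^ 2) (q ^ 2) (Suc n) * qpoch (- q) q (2 * Suc n)) =
     1 / (qpoch (q ^ 2) (q ^ 2) n * qpoch (- q) q (2 * n)) / (1 + q powi (2 * int n + 1)) / (1 - (q ^ 2) powi (2 * int n + 2))"
    unfolding f pw(1) e qpoch_Suc
    by (simp only: divide_divide_eq_left mult_minus_left diff_minus_eq_add mult_ac)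
  then show ?case
    using bailey_even_step[OF _ bailey_odd_step[OF _ Suc.IH]] by (simp add: add_ac)
qed

lemma bailey_pair_odd:
  "((\<lambda>r. theta_term (q ^ 3) (q ^ 2) r * (rq (q ^ 2) (int n - r) * rq (q ^ 2) (int n + 1 + r))) has_sum
     (1 / (qpoch (q ^ 2) (q ^ 2) n * qpoch (- q) q (2 * n + 1)))) UNIV"
proof -
  have "q powi (2 * int n + 1) = q * q ^ (2 * n)"
    by (simp add: power_int_def nat_add_distrib nat_mult_distrib)
  then show ?thesis
    using bailey_odd_step[OF _ bailey_pair_even[of n]] by (simp add: qpoch_Suc mult_ac)
qed

lemma bailey_pair_odd_reflected:
  "((\<lambda>r. theta_term (q ^ 3) (q ^ 1) r * (rq (q ^ 2) (int n - r) * rq (q ^ 2) (int n + 1 + r))) has_sum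
     (1 / (qpoch (q ^ 2) (q ^ 2) n * qpoch (- q) q (2 * n)))) UNIV"
  by (rule bailey_odd_step_reflected[OF _ bailey_pair_even]) simp

end

section \<open>Passage to the limit\<close>

text \<open>Tannery's theorem for unordered sums: they are integrals over the counting measure, to
  which dominated convergence applies.\<close>

lemma tendsto_has_sum_dominated:
  fixes f :: "nat \<Rightarrow> 'a \<Rightarrow> complex"
  assumes S: "\<And>n. (f n has_sum S n) UNIV"
    and lim: "\<And>x. (\<lambda>n. f n x) \<longlonglongrightarrow> g x"
    and bound: "\<And>n x. norm (f n x) \<le> M x" and M: "M summable_on UNIV"
  shows "g summable_on UNIV" "S \<longlonglongrightarrow> infsum g UNIV"
proof -
  have M0: "norm (M x) = M x" for x
    using order_trans[OF norm_ge_zero bound[of undefined x]] by simp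
  have "integrable (count_space UNIV) M"
    using M abs_summable_equivalent[of M UNIV]
    unfolding M0 Infinite_Set_Sum.abs_summable_on_def by simp
  note dom = this
  have ev: "AE x in count_space UNIV. (\<lambda>n. f n x) \<longlonglongrightarrow> g x"
    "\<And>n. AE x in count_space UNIV. norm (f n x) \<le> M x"
    using lim bound by auto
  have conv: "infsum h UNIV = integral\<^sup>L (count_space UNIV) h \<and> h summable_on UNIV"
    if "integrable (count_space UNIV) h" for h :: "'a \<Rightarrow> complex"
  proof -
    have a: "Infinite_Set_Sum.abs_summable_on h UNIV"
      using that unfolding Infinite_Set_Sum.abs_summable_on_def .
    then have "(\<lambda>x. norm (h x)) summable_on UNIV"
      using abs_summable_equivalent by blast
    then show ?thesis
      using infsetsum_infsum[OF a] abs_summable_summable unfolding infsetsum_def by metis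
  qed
  have g: "integrable (count_space UNIV) g"
    by (rule integrable_dominated_convergence[OF _ _ dom ev]) simp_all
  then show "g summable_on UNIV" using conv by blast
  have "integrable (count_space UNIV) (f n)" for n
    by (rule integrable_dominated_convergence2[OF _ _ dom ev]) simp_all
  then have "S = (\<lambda>n. integral\<^sup>L (count_space UNIV) (f n))"
    using conv infsumI[OF S] by (intro ext) metis
  moreover have "(\<lambda>n. integral\<^sup>L (count_space UNIV) (f n)) \<longlonglongrightarrow> integral\<^sup>L (count_space UNIV) g"
    by (rule integral_dominated_convergence[OF _ _ dom ev]) simp_all
  ultimately show "S \<longlonglongrightarrow> infsum g UNIV" using conv[OF g] by (simp only:)
qed

lemma has_sum_finite_sum:
  fixes f :: "'a \<Rightarrow> 'b \<Rightarrow> complex"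
  assumes "finite A" "\<And>n. n \<in> A \<Longrightarrow> (f n has_sum s n) UNIV"
  shows "((\<lambda>x. \<Sum>n\<in>A. f n x) has_sum (\<Sum>n\<in>A. s n)) UNIV"
  using assms by (induction A rule: finite_induct) (auto intro!: has_sum_add)

section \<open>Limits and bounds of q-factorials\<close>

lemma convergent_prod_qpoch:
  fixes a p :: complex
  assumes "norm p < 1"
  shows "convergent_prod (\<lambda>k. 1 - a * p ^ k)"
proof -
  have "summable (\<lambda>k. norm a * norm p ^ k)"
    using assms by (intro summable_mult summable_geometric) simp
  then have "summable (\<lambda>k. norm ((1 - a * p ^ k) - 1))"
    by (simp add: norm_mult norm_power)
  then show ?thesis
    by (intro abs_convergent_prod_imp_convergent_prod summable_imp_abs_convergent_prod)
qed

lemma qpoch_tendsto: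
  assumes "norm p < 1"
  shows "qpoch a p \<longlonglongrightarrow> qpoch_inf a p"
proof -
  \<comment> \<open>The partial products in \<open>convergent_prod_LIMSEQ\<close> include the index
    n, hence \<open>Suc n\<close>.\<close>
  have "(\<lambda>n. qpoch a p (Suc n)) \<longlonglongrightarrow> qpoch_inf a p"
    using convergent_prod_LIMSEQ[OF convergent_prod_qpoch[OF assms, of a]]
    unfolding qpoch_def qpoch_inf_def lessThan_Suc_atMost .
  then show ?thesis by (rule LIMSEQ_imp_Suc)
qed

lemma qpoch_inf_nz:
  assumes "norm a < 1" "norm p < 1"
  shows "qpoch_inf a p \<noteq> 0"
  unfolding qpoch_inf_def
proof (rule prodinf_nonzero[OF convergent_prod_qpoch[OF assms(2)]])
  fix k
  have "qpoch a p (Suc k) \<noteq> 0" using qpoch_nz[OF assms] .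
  then show "1 - a * p ^ k \<noteq> 0" by (simp add: qpoch_Suc)
qed

lemma inverse_qpoch_bounded:
  assumes "norm a < 1" "norm p < 1"
  obtains C where "\<And>n. norm (1 / qpoch a p n) \<le> C"
proof -
  have "(\<lambda>n. 1 / qpoch a p n) \<longlonglongrightarrow> 1 / qpoch_inf a p"
    by (intro tendsto_intros qpoch_tendsto qpoch_inf_nz assms)
  then have "Bseq (\<lambda>n. 1 / qpoch a p n)"
    by (intro convergent_imp_Bseq convergentI)
  then show ?thesis using that by (auto simp: Bseq_def)
qed

lemma rq_bounded:
  assumes "norm p < 1"
  obtains C where "C \<ge> 0" "\<And>i. norm (rq p i) \<le> C"
proof -
  obtain C where C: "\<And>n. norm (1 / qpoch p p n) \<le> C"
    using inverse_qpoch_bounded[OF assms assms] by blast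
  have "0 \<le> C" using C[of 0] by simp
  with C that[of C] show ?thesis by (auto simp: rq_def)
qed

lemma rq_tendsto:
  assumes "norm p < 1"
  shows "(\<lambda>N. rq p (int N + k)) \<longlonglongrightarrow> 1 / qpoch_inf p p"
proof -
  have 1: "(\<lambda>n. 1 / qpoch p p n) \<longlonglongrightarrow> 1 / qpoch_inf p p"
    by (intro tendsto_intros qpoch_tendsto qpoch_inf_nz assms)
  have "filterlim (\<lambda>N. nat (int N + k)) at_top at_top"
    unfolding filterlim_at_top
  proof
    fix Z
    show "eventually (\<lambda>N. Z \<le> nat (int N + k)) at_top"
      using eventually_ge_at_top[of "Z + nat \<bar>k\<bar>"] by eventually_elim linarith
  qed
  from filterlim_compose[OF 1 this]
  have "(\<lambda>N. 1 / qpoch p p (nat (int N + k))) \<longlonglongrightarrow> 1 / qpoch_inf p p" .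
  moreover have "eventually (\<lambda>N. 1 / qpoch p p (nat (int N + k)) = rq p (int N + k)) at_top"
    using eventually_ge_at_top[of "nat \<bar>k\<bar>"] by eventually_elim (simp add: rq_def)
  ultimately show ?thesis by (rule Lim_transform_eventually)
qed

lemma rq_product_tendsto:
  assumes "norm p < 1"
  shows "(\<lambda>N. rq p (int N - r) * rq p (int N + d + r)) \<longlonglongrightarrow> (1 / qpoch_inf p p) ^ 2"
  using tendsto_mult[OF rq_tendsto[OF assms, of "- r"] rq_tendsto[OF assms, of "d + r"]]
  by (simp add: power2_eq_square add.assoc)

text \<open>For fixed r both \<open>rq\<close> factors tend to 1/(p;p)_infinity, and their uniform
  bound makes a multiple of \<open>norm (h r)\<close> a dominating series.\<close>

lemma has_sum_rq_product_tendsto: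
  assumes p: "norm p < 1" and h: "(\<lambda>r. norm (h r)) summable_on UNIV"
    and S: "\<And>N. ((\<lambda>r. h r * (rq p (int N - r) * rq p (int N + d + r))) has_sum S N) UNIV"
  shows "S \<longlonglongrightarrow> infsum h UNIV * (1 / qpoch_inf p p) ^ 2"
proof -
  obtain C where C: "C \<ge> 0" "\<And>i. norm (rq p i) \<le> C" using rq_bounded[OF p] by blast
  have "S \<longlonglongrightarrow> (\<Sum>\<^sub>\<infinity>r. h r * (1 / qpoch_inf p p) ^ 2)"
  proof (rule tendsto_has_sum_dominated(2)[OF S])
    show "(\<lambda>N. h r * (rq p (int N - r) * rq p (int N + d + r))) \<longlonglongrightarrow> h r * (1 / qpoch_inf p p) ^ 2" for r
      by (intro tendsto_mult tendsto_const rq_product_tendsto p)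
    show "norm (h r * (rq p (int N - r) * rq p (int N + d + r))) \<le> norm (h r) * (C * C)" for N r
      unfolding norm_mult using C by (intro mult_left_mono mult_mono) auto
    show "(\<lambda>r. norm (h r) * (C * C)) summable_on UNIV"
      using h by (rule summable_on_cmult_left)
  qed
  then show ?thesis
    using infsum_cmult_left'[of h "(1 / qpoch_inf p p) ^ 2" UNIV] by simp
qed

section \<open>The Jacobi triple product\<close>

lemma theta_term_summable_nat:
  assumes p: "norm p < 1" "p \<noteq> 0" and z: "z \<noteq> 0"
  shows "summable (\<lambda>n. norm (theta_term p z (int n)))"
proof -
  have "(\<lambda>n. norm z * norm p ^ n) \<longlonglongrightarrow> norm z * 0"
    using p by (intro tendsto_intros LIMSEQ_power_zero) auto
  then have "eventually (\<lambda>n. norm z * norm p ^ n < 1/2) at_top"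
    by (rule order_tendstoD) simp
  then obtain N where N: "\<And>n. n \<ge> N \<Longrightarrow> norm z * norm p ^ n < 1/2"
    by (auto simp: eventually_at_top_linorder)
  show ?thesis
  proof (rule summable_ratio_test[of "1/2" N])
    fix n assume "n \<ge> N"
    have "theta_term p z (int (Suc n)) = - z * p ^ n * theta_term p z (int n)"
      using theta_term_add_1[OF p(2) z, of "int n"] by (simp add: add.commute)
    then have "norm (theta_term p z (int (Suc n))) = (norm z * norm p ^ n) * norm (theta_term p z (int n))"
      by (simp add: norm_mult norm_power)
    also have "\<dots> \<le> 1/2 * norm (theta_term p z (int n))"
      using N[OF \<open>n \<ge> N\<close>] by (intro mult_right_mono) auto
    finally show "norm (norm (theta_term p z (int (Suc n)))) \<le> 1/2 * norm (norm (theta_term p z (int n)))"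
      by simp
  qed simp
qed

lemma theta_term_summable:
  assumes p: "norm p < 1" "p \<noteq> 0" and z: "z \<noteq> 0"
  shows "(\<lambda>r. norm (theta_term p z r)) summable_on UNIV"
proof -
  have nat: "(\<lambda>r. norm (theta_term p w r)) summable_on (int ` UNIV)" if "w \<noteq> 0" for w
    using theta_term_summable_nat[OF p that]
    by (subst summable_on_reindex) (auto simp: o_def summable_nonneg_imp_summable_on)
  \<comment> \<open>The negative half is the nonnegative half for the parameter p/z.\<close>
  have "(\<lambda>r. norm (theta_term p z r)) summable_on (uminus ` int ` UNIV)"
    using nat[of "p / z"] p z
    by (subst summable_on_reindex) (auto simp: o_def theta_term_minus)
  \<comment> \<open>Both halves contain 0; it is removed from one to make the union
    disjoint.\<close>
  then have "(\<lambda>r. norm (theta_term p z r)) summable_on (uminus ` int ` UNIV - int ` UNIV)"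
    by (rule summable_on_subset_banach) auto
  with nat[OF z]
  have "(\<lambda>r. norm (theta_term p z r)) summable_on (int ` UNIV \<union> (uminus ` int ` UNIV - int ` UNIV))"
    by (intro summable_on_Un_disjoint) auto
  also have "int ` UNIV \<union> (uminus ` int ` UNIV - int ` UNIV) = UNIV"
  proof -
    have "r \<in> int ` UNIV \<union> uminus ` int ` UNIV" for r
      by (cases r rule: int_cases2) auto
    then show ?thesis by auto
  qed
  finally show ?thesis .
qed

text \<open>In the limit of the finite form, the sum side carries 1/(p;p)_infinity squared and the
  product side carries it once; the surplus becomes the third factor.\<close>

theorem jacobi_triple_product:
  assumes p: "norm p < 1" "p \<noteq> 0" and z: "z \<noteq> 0"
  shows "(\<Sum>\<^sub>\<infinity>r. theta_term p z r) = qpoch_inf z p * qpoch_inf (p / z) p * qpoch_inf p p"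
proof -
  have nz: "qpoch_inf p p \<noteq> 0" by (rule qpoch_inf_nz[OF p(1) p(1)])
  have "(\<lambda>n. qpoch z p n * qpoch (p / z) p n / qpoch p p (2 * n)) \<longlonglongrightarrow>
      (\<Sum>\<^sub>\<infinity>r. theta_term p z r) * (1 / qpoch_inf p p) ^ 2"
    by (rule has_sum_rq_product_tendsto[where d = 0, OF p(1) theta_term_summable[OF p z]])
      (use finite_triple_product[OF p z] in simp)
  moreover have "filterlim (\<lambda>n::nat. 2 * n) at_top at_top"
    by (rule filterlim_subseq) (simp add: strict_mono_def)
  from filterlim_compose[OF qpoch_tendsto[OF p(1), of p] this]
  have "(\<lambda>n. qpoch p p (2 * n)) \<longlonglongrightarrow> qpoch_inf p p" .
  then have "(\<lambda>n. qpoch z p n * qpoch (p / z) p n / qpoch p p (2 * n)) \<longlonglongrightarrow>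
      qpoch_inf z p * qpoch_inf (p / z) p / qpoch_inf p p"
    using nz by (intro tendsto_intros qpoch_tendsto p(1))
  ultimately have "(\<Sum>\<^sub>\<infinity>r. theta_term p z r) * (1 / qpoch_inf p p) ^ 2 =
      qpoch_inf z p * qpoch_inf (p / z) p / qpoch_inf p p"
    by (rule LIMSEQ_unique)
  then show ?thesis using nz by (simp add: field_simps power2_eq_square)
qed

section \<open>The Bailey chain and its limit\<close>

text \<open>A finite conjugate Bailey pair: k = s + r turns the sum into q-Vandermonde with n = N -
  r and b = 2r + d. It is the source of the weight p^(r(r+d)).\<close>

lemma bailey_kernel_chain:
  assumes p: "norm p < 1" "p \<noteq> 0" and d: "d \<le> 1"
  shows "(\<Sum>k\<le>N. p ^ (k * (k + d)) * rq p (int N - int k) * (rq p (int k - r) * rq p (int k + int d + r)))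
    = p powi (r * (r + int d)) * (rq p (int N - r) * rq p (int N + int d + r))"
proof -
  define F where "F = (\<lambda>k. p powi (k * (k + int d)) * rq p (int N - k) * (rq p (k - r) * rq p (k + int d + r)))"
  have "(F has_sum p powi (r * (r + int d)) * (rq p (int N - r) * rq p (int N + int d + r))) UNIV"
  proof (cases "r > int N")
    case True
    \<comment> \<open>A nonzero term would need r <= k <= N.\<close>
    then have "F k = 0" for k by (cases "k < r") (auto simp: F_def)
    then have "F = (\<lambda>_. 0)" by blast
    with True show ?thesis by simp
  next
    case False
    then have n: "int (nat (int N - r)) = int N - r" by simp
    show ?thesis
    proof (rule has_sum_shift_int[where k = r])
      have "F (s + r) = p powi (r * (r + int d)) *
        (p powi (s * (s + (2 * r + int d))) * (rq p (int N - r - s) * rq p s * rq p (s + (2 * r + int d))))" for s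
      proof -
        have "(s + r) * (s + r + int d) = r * (r + int d) + s * (s + (2 * r + int d))"
          by (simp add: algebra_simps)
        moreover have "int N - (s + r) = int N - r - s" "s + r - r = s" "s + r + int d + r = s + (2 * r + int d)"
          by simp_all
        ultimately show ?thesis
          unfolding F_def by (simp only: power_int_add[OF disjI1[OF p(2)]] mult.assoc)
      qed
      moreover have "int N - r + (2 * r + int d) = int N + int d + r" by simp
      ultimately show "((\<lambda>s. F (s + r)) has_sum
          p powi (r * (r + int d)) * (rq p (int N - r) * rq p (int N + int d + r))) UNIV"
        using has_sum_cmult_right[OF q_vandermonde[OF p, of "2 * r + int d" "nat (int N - r)"],
            of "p powi (r * (r + int d))"]
        unfolding n by (simp only:)
    qed
  qed
  also have "(F has_sum p powi (r * (r + int d)) * (rq p (int N - r) * rq p (int N + int d + r))) UNIV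
    \<longleftrightarrow> (F has_sum p powi (r * (r + int d)) * (rq p (int N - r) * rq p (int N + int d + r))) (int ` {..N})"
  proof (rule has_sum_cong_neutral)
    fix k assume "k \<in> UNIV - int ` {..N}"
    then have "k < 0 \<or> k > int N" 
      by (metis Diff_iff atMost_iff image_eqI int_nat_eq linorder_not_less nat_le_iff)
    \<comment> \<open>Nonzero factors need k >= r and k + d + r >= 0, hence 2k + d >= 0, which k <=
      -1 and d <= 1 exclude.\<close>
    moreover have "rq p (k - r) * rq p (k + int d + r) = 0" if "k < 0"
      using that d by (cases "k < r") auto
    ultimately show "F k = 0" by (auto simp: F_def)
  qed auto
  finally have "sum F (int ` {..N}) = p powi (r * (r + int d)) * (rq p (int N - r) * rq p (int N + int d + r))"
    using has_sum_finite[of "int ` {..N}" F] has_sum_unique by blast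
  moreover have "sum F (int ` {..N}) = (\<Sum>k\<le>N. F (int k))"
    by (subst sum.reindex) (auto simp: o_def)
  moreover have "p powi (int k * (int k + int d)) = p ^ (k * (k + d))" for k
    by (metis of_nat_add of_nat_mult power_int_of_nat)
  ultimately show ?thesis by (simp only: F_def)
qed

text \<open>\<open>S N\<close> has two limits: inserting the pair and summing over n by the kernel
  leaves the weighted \<alpha> sum over (p;p)_infinity squared, while termwise convergence in n,
  dominated thanks to B, leaves the \<beta> sum over (p;p)_infinity. The values d = 0 and d = 1
  correspond to the Bailey parameters a = 1 and a = p.\<close>

lemma bailey_limit:
  assumes p: "norm p < 1" "p \<noteq> 0" and d: "d \<le> 1"
    and pair: "\<And>n. ((\<lambda>r. \<alpha> r * (rq p (int n - r) * rq p (int n + int d + r))) has_sum \<beta> n) UNIV"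
    and \<alpha>: "(\<lambda>r. norm (p powi (r * (r + int d)) * \<alpha> r)) summable_on UNIV"
    and \<beta>: "\<And>n. norm (\<beta> n) \<le> B"
  shows "(\<lambda>n. p ^ (n * (n + d)) * \<beta> n) sums
    ((\<Sum>\<^sub>\<infinity>r. p powi (r * (r + int d)) * \<alpha> r) / qpoch_inf p p)"
proof -
  let ?L = "qpoch_inf p p"
  have nz: "?L \<noteq> 0" by (rule qpoch_inf_nz[OF p(1) p(1)])
  obtain C where C: "C \<ge> 0" "\<And>i. norm (rq p i) \<le> C" using rq_bounded[OF p(1)] by blast
  have B: "B \<ge> 0" using norm_ge_zero \<beta> order_trans by blast
  define S where "S N = (\<Sum>n\<le>N. p ^ (n * (n + d)) * rq p (int N - int n) * \<beta> n)" for N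
  have "S \<longlonglongrightarrow> (\<Sum>\<^sub>\<infinity>r. p powi (r * (r + int d)) * \<alpha> r) * (1 / ?L) ^ 2"
  proof (rule has_sum_rq_product_tendsto[OF p(1) \<alpha>])
    fix N
    have "((\<lambda>r. \<Sum>n\<le>N. p ^ (n * (n + d)) * rq p (int N - int n) *
        (\<alpha> r * (rq p (int n - r) * rq p (int n + int d + r)))) has_sum S N) UNIV"
      unfolding S_def by (intro has_sum_finite_sum has_sum_cmult_right pair) simp
    also have "(\<lambda>r. \<Sum>n\<le>N. p ^ (n * (n + d)) * rq p (int N - int n) *
        (\<alpha> r * (rq p (int n - r) * rq p (int n + int d + r)))) =
        (\<lambda>r. p powi (r * (r + int d)) * \<alpha> r * (rq p (int N - r) * rq p (int N + int d + r)))"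
    proof
      fix r
      have "(\<Sum>n\<le>N. p ^ (n * (n + d)) * rq p (int N - int n) *
        (\<alpha> r * (rq p (int n - r) * rq p (int n + int d + r)))) = \<alpha> r * (\<Sum>n\<le>N. p ^ (n * (n + d)) * rq p (int N - int n) *
        (rq p (int n - r) * rq p (int n + int d + r)))"
        by (simp add: sum_distrib_left mult_ac)
      then show "(\<Sum>n\<le>N. p ^ (n * (n + d)) * rq p (int N - int n) *
        (\<alpha> r * (rq p (int n - r) * rq p (int n + int d + r)))) =
        p powi (r * (r + int d)) * \<alpha> r * (rq p (int N - r) * rq p (int N + int d + r))"
        unfolding bailey_kernel_chain[OF p d] by (simp only: mult_ac)
    qed
    finally show "((\<lambda>r. p powi (r * (r + int d)) * \<alpha> r * (rq p (int N - r) * rq p (int N + int d + r)))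
        has_sum S N) UNIV" .
  qed
  moreover have summ: "(\<lambda>n. norm p ^ n * C * B) summable_on UNIV"
    using p C(1) B by (intro summable_nonneg_imp_summable_on summable_mult2 summable_geometric) auto
  have le: "norm p ^ (n * (n + d)) \<le> norm p ^ n" for n
  proof (rule power_decreasing)
    show "n \<le> n * (n + d)" by (cases n) auto
  qed (use p in auto)
  have dom: "(\<lambda>n. p ^ (n * (n + d)) * \<beta> n / ?L) summable_on UNIV"
    "S \<longlonglongrightarrow> (\<Sum>\<^sub>\<infinity>n. p ^ (n * (n + d)) * \<beta> n / ?L)"
  proof -
    have S: "((\<lambda>n. p ^ (n * (n + d)) * rq p (int N - int n) * \<beta> n) has_sum S N) UNIV" for N
    proof -
      have "((\<lambda>n. p ^ (n * (n + d)) * rq p (int N - int n) * \<beta> n) has_sum S N) {..N}"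
        unfolding S_def by (rule has_sum_finite) simp
      also have "((\<lambda>n. p ^ (n * (n + d)) * rq p (int N - int n) * \<beta> n) has_sum S N) {..N} \<longleftrightarrow> ?thesis"
        by (rule has_sum_cong_neutral) auto
      finally show ?thesis .
    qed
    have lim: "(\<lambda>N. p ^ (n * (n + d)) * rq p (int N - int n) * \<beta> n) \<longlonglongrightarrow> p ^ (n * (n + d)) * \<beta> n / ?L" for n
      using tendsto_mult[OF tendsto_const[of "p ^ (n * (n + d)) * \<beta> n"] rq_tendsto[OF p(1), of "- int n"]]
      by (simp add: mult_ac)
    have bd: "norm (p ^ (n * (n + d)) * rq p (int N - int n) * \<beta> n) \<le> norm p ^ n * C * B" for n N
      unfolding norm_mult norm_power using C B le \<beta> by (intro mult_mono) auto
    show "(\<lambda>n. p ^ (n * (n + d)) * \<beta> n / ?L) summable_on UNIV"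
      "S \<longlonglongrightarrow> (\<Sum>\<^sub>\<infinity>n. p ^ (n * (n + d)) * \<beta> n / ?L)"
      using tendsto_has_sum_dominated[OF S lim bd summ] by blast+
  qed
  ultimately have eq: "(\<Sum>\<^sub>\<infinity>n. p ^ (n * (n + d)) * \<beta> n / ?L) =
      (\<Sum>\<^sub>\<infinity>r. p powi (r * (r + int d)) * \<alpha> r) * (1 / ?L) ^ 2"
    using LIMSEQ_unique by blast
  have "((\<lambda>n. ?L * (p ^ (n * (n + d)) * \<beta> n / ?L)) has_sum
      (?L * ((\<Sum>\<^sub>\<infinity>r. p powi (r * (r + int d)) * \<alpha> r) * (1 / ?L) ^ 2))) UNIV"
    using has_sum_cmult_right[OF has_sum_infsum[OF dom(1)], of ?L] unfolding eq .
  moreover have "?L * (x / ?L) = x" "?L * (x * (1 / ?L) ^ 2) = x / ?L" for x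
    using nz by (simp_all add: power2_eq_square)
  ultimately have "((\<lambda>n. p ^ (n * (n + d)) * \<beta> n) has_sum
      ((\<Sum>\<^sub>\<infinity>r. p powi (r * (r + int d)) * \<alpha> r) / ?L)) UNIV"
    by (simp only:)
  then show ?thesis by (rule has_sum_imp_sums)
qed

text \<open>Since 2r^2 = 4 (r(r-1)/2) + 2r, the weight raises the base exponent from 3 to 7 and k by
  2 + 2d. This is the origin of the modulus 7.\<close>

lemma theta_term_weight:
  fixes q :: complex
  assumes "q \<noteq> 0"
  shows "(q ^ 2) powi (r * (r + int d)) * theta_term (q ^ 3) (q ^ k) r = theta_term (q ^ 7) (q ^ (k + 2 + 2 * d)) r"
proof -
  define t where "t = r * (r - 1) div 2"
  have "even (r * (r - 1))" by simp
  then have "r * (r - 1) = 2 * t" by (simp add: t_def)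
  then have rr: "r * r = 2 * t + r" by (simp add: algebra_simps)
  have tt: "theta_term (q ^ m) (q ^ j) r = (-1) powi r * q powi (int j * r + int m * t)" for m j
    unfolding theta_term_def t_def[symmetric]
    using assms power_int_mult_distrib[of "-1" "q ^ j" r]
    by (simp add: power_int_add power_int_power)
  have "2 * (r * (r + int d)) + (int k * r + 3 * t) = int (k + 2 + 2 * d) * r + 7 * t"
    using rr by (simp add: algebra_simps)
  then have "q powi (2 * (r * (r + int d))) * q powi (int k * r + 3 * t) = q powi (int (k + 2 + 2 * d) * r + 7 * t)"
    by (simp only: power_int_add[OF disjI1[OF assms], symmetric])
  then show ?thesis
    unfolding tt by (simp add: power_int_power)
qed

text \<open>The triple product at p = q^7 and z = q^j, where p/z = q^j'. The cases (k, d) = (2, 0),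
  (1, 1), (2, 1) give (j, j') = (4, 3), (5, 2), (6, 1).\<close>

lemma rogers_selberg:
  fixes q :: complex
  assumes q: "norm q < 1" "q \<noteq> 0" and d: "d \<le> 1" and j: "j = k + 2 + 2 * d" "j + j' = 7"
    and pair: "\<And>n. ((\<lambda>r. theta_term (q ^ 3) (q ^ k) r *
        (rq (q ^ 2) (int n - r) * rq (q ^ 2) (int n + int d + r))) has_sum \<beta> n) UNIV"
    and \<beta>: "\<And>n. norm (\<beta> n) \<le> B"
  shows "(\<lambda>n. (q ^ 2) ^ (n * (n + d)) * \<beta> n) sums
    (qpoch_inf (q ^ j) (q ^ 7) * qpoch_inf (q ^ j') (q ^ 7) * qpoch_inf (q ^ 7) (q ^ 7) / qpoch_inf (q ^ 2) (q ^ 2))"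
proof -
  have q7: "norm (q ^ 7) < 1" "q ^ 7 \<noteq> 0" "q ^ j \<noteq> 0"
    using q by (auto simp: norm_power power_less_one_iff)
  have "q ^ 7 / q ^ j = q ^ j'"
    using q j(2) by (metis nonzero_mult_div_cancel_left power_add power_not_zero)
  then have jtp: "(\<Sum>\<^sub>\<infinity>r. theta_term (q ^ 7) (q ^ j) r) =
      qpoch_inf (q ^ j) (q ^ 7) * qpoch_inf (q ^ j') (q ^ 7) * qpoch_inf (q ^ 7) (q ^ 7)"
    using jacobi_triple_product[OF q7] by simp
  show ?thesis
    using bailey_limit[OF q2[OF q] d pair _ \<beta>] theta_term_summable[OF q7]
    unfolding theta_term_weight[OF q(2)] j(1)[symmetric] jtp by blast
qed

lemma weighted_summable:
  fixes q :: complex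
  assumes q: "norm q < 1" and \<beta>: "\<And>n. norm (\<beta> n) \<le> B"
  shows "summable (\<lambda>n. q ^ (2 * n ^ 2 + 2 * m * n) * \<beta> n)"
proof (rule summable_comparison_test')
  show "summable (\<lambda>n. norm q ^ n * B)"
    using q by (intro summable_mult2 summable_geometric) simp
  fix n :: nat assume "n \<ge> 0"
  have "n \<le> 2 * n ^ 2 + 2 * m * n"
    by (cases n) (auto simp: power2_eq_square)
  then have "norm q ^ (2 * n ^ 2 + 2 * m * n) \<le> norm q ^ n"
    using q by (intro power_decreasing) auto
  then show "norm (q ^ (2 * n ^ 2 + 2 * m * n) * \<beta> n) \<le> norm q ^ n * B"
    unfolding norm_mult norm_power using \<beta> by (intro mult_mono) auto
qed

section \<open>Recursions in m\<close>

context
  fixes q :: complex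
  assumes q: "norm q < 1" "q \<noteq> 0"
begin

definition even_coeff :: "nat \<Rightarrow> complex" where
  "even_coeff n = 1 / (qpoch (q ^ 2) (q ^ 2) n * qpoch (- q) q (2 * n))"

definition odd_coeff :: "nat \<Rightarrow> complex" where
  "odd_coeff n = 1 / (qpoch (q ^ 2) (q ^ 2) n * qpoch (- q) q (2 * n + 1))"

definition even_sum :: "nat \<Rightarrow> complex" where
  "even_sum m = (\<Sum>n. q ^ (2 * n ^ 2 + 2 * m * n) * even_coeff n)"

definition odd_sum :: "nat \<Rightarrow> complex" where
  "odd_sum m = (\<Sum>n. q ^ (2 * n ^ 2 + 2 * m * n) * odd_coeff n)"

lemma coeff_bounded:
  obtains B where "\<And>n. norm (even_coeff n) \<le> B" "\<And>n. norm (odd_coeff n) \<le> B"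
proof -
  obtain C where C: "\<And>n. norm (1 / qpoch (q ^ 2) (q ^ 2) n) \<le> C"
    using inverse_qpoch_bounded[OF q2(1)[OF q] q2(1)[OF q]] by blast
  obtain D where D: "\<And>n. norm (1 / qpoch (- q) q n) \<le> D"
    using inverse_qpoch_bounded[of "- q" q] q by auto
  have "norm (1 / (qpoch (q ^ 2) (q ^ 2) n * qpoch (- q) q k)) \<le> C * D" for n k
  proof -
    have "norm (1 / (qpoch (q ^ 2) (q ^ 2) n * qpoch (- q) q k))
      = norm (1 / qpoch (q ^ 2) (q ^ 2) n) * norm (1 / qpoch (- q) q k)"
      by (simp add: norm_divide norm_mult)
    also have "\<dots> \<le> C * D"
      using C[of n] order_trans[OF norm_ge_zero C] by (intro mult_mono D) auto
    finally show ?thesis .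
  qed
  then show ?thesis
    using that[of "C * D"] unfolding even_coeff_def odd_coeff_def by blast
qed

lemma even_sums: "(\<lambda>n. q ^ (2 * n ^ 2 + 2 * m * n) * even_coeff n) sums even_sum m"
  and odd_sums: "(\<lambda>n. q ^ (2 * n ^ 2 + 2 * m * n) * odd_coeff n) sums odd_sum m"
proof -
  obtain B where "\<And>n. norm (even_coeff n) \<le> B" "\<And>n. norm (odd_coeff n) \<le> B"
    using coeff_bounded by blast
  then show "(\<lambda>n. q ^ (2 * n ^ 2 + 2 * m * n) * even_coeff n) sums even_sum m"
    "(\<lambda>n. q ^ (2 * n ^ 2 + 2 * m * n) * odd_coeff n) sums odd_sum m"
    unfolding even_sum_def odd_sum_def using weighted_summable[OF q(1)] by (blast intro: summable_sums)+
qed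

lemma one_plus_ne_0: "1 + q ^ Suc k \<noteq> 0"
proof
  assume "1 + q ^ Suc k = 0"
  then have "(q ^ Suc k) ^ 2 = 1"
    by (simp add: add_eq_0_iff power2_eq_square)
  then have "q ^ (Suc k * 2) = 1" by (simp only: power_mult)
  with power_ne_1[OF q(1), of "Suc k * 2"] show False by simp
qed

text \<open>The coefficients differ by the factor 1 + q^(2n+1), and replacing m by m + 1 multiplies
  the n-th term by q^(2n).\<close>

lemma odd_sum_add: "odd_sum m + q * odd_sum (m + 1) = even_sum m"
proof -
  have "q ^ (2 * n ^ 2 + 2 * m * n) * odd_coeff n + q * (q ^ (2 * n ^ 2 + 2 * (m + 1) * n) * odd_coeff n)
     = q ^ (2 * n ^ 2 + 2 * m * n) * even_coeff n" for n
  proof -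
    have "2 * n ^ 2 + 2 * (m + 1) * n = (2 * n ^ 2 + 2 * m * n) + 2 * n" by (simp add: algebra_simps)
    then have "q ^ (2 * n ^ 2 + 2 * (m + 1) * n) = q ^ (2 * n ^ 2 + 2 * m * n) * q ^ (2 * n)"
      by (simp only: power_add)
    moreover have "even_coeff n = (1 + q ^ Suc (2 * n)) * odd_coeff n"
      using one_plus_ne_0[of "2 * n"] by (simp add: even_coeff_def odd_coeff_def qpoch_Suc)
    ultimately show ?thesis by (simp add: algebra_simps)
  qed
  with sums_add[OF odd_sums[of m] sums_mult[OF odd_sums[of "m + 1"], of q]]
  have "(\<lambda>n. q ^ (2 * n ^ 2 + 2 * m * n) * even_coeff n) sums (odd_sum m + q * odd_sum (m + 1))"
    by (simp only:)
  then show ?thesis using even_sums sums_unique2 by blast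
qed

text \<open>The n-th term acquires 1 - q^(4n) = (1 - q^(2n))(1 + q^(2n)). This kills the term n = 0
  and otherwise removes the last factor of both q-factorials, leaving the odd coefficient at n -
  1.\<close>

lemma even_sum_diff: "even_sum m - even_sum (m + 2) = q ^ (2 * m + 2) * odd_sum (m + 2)"
proof -
  define f where "f n = q ^ (2 * n ^ 2 + 2 * m * n) * even_coeff n - q ^ (2 * n ^ 2 + 2 * (m + 2) * n) * even_coeff n" for n
  have f: "f sums (even_sum m - even_sum (m + 2))"
    unfolding f_def by (intro sums_diff even_sums)
  have "f (Suc n) = q ^ (2 * m + 2) * (q ^ (2 * n ^ 2 + 2 * (m + 2) * n) * odd_coeff n)" for n
  proof -
    have e: "2 * Suc n ^ 2 + 2 * m * Suc n = (2 * m + 2) + (2 * n ^ 2 + 2 * (m + 2) * n)"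
      "2 * Suc n ^ 2 + 2 * (m + 2) * Suc n = (2 * m + 2) + (2 * n ^ 2 + 2 * (m + 2) * n) + (2 * n + 2) + (2 * n + 2)"
      by (simp_all add: power2_eq_square algebra_simps)
    have q22: "q ^ 2 * (q ^ 2) ^ n = q ^ (2 * n + 2)" "q * q ^ Suc (2 * n) = q ^ (2 * n + 2)"
      by (simp_all add: power_mult[symmetric] power_add[symmetric] flip: power_Suc)
    have e2: "2 * Suc n = Suc (Suc (2 * n))" by simp
    have nz: "1 - q ^ (2 * n + 2) \<noteq> 0" "1 + q ^ (2 * n + 2) \<noteq> 0"
      using one_plus_ne_0[of "2 * n + 1"] power_ne_1[OF q(1), of "2 * n + 2"] by simp_all
    have odd: "odd_coeff n = (1 - q ^ (2 * n + 2)) * (1 + q ^ (2 * n + 2)) * even_coeff (Suc n)"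
      unfolding even_coeff_def odd_coeff_def e2 qpoch_Suc q22 mult_minus_left Suc_eq_plus1[symmetric]
      using nz by simp
    have split: "q ^ (a + b + c + c) = q ^ a * q ^ b * q ^ c * q ^ c" for a b c
      by (simp add: power_add)
    have ring: "x * y * v - x * y * z * z * v = x * (y * ((1 - z) * (1 + z) * v))" for x y z v :: complex
      by (simp add: algebra_simps)
    show ?thesis
      by (unfold f_def e split power_add[of q "2 * m + 2" "2 * n ^ 2 + 2 * (m + 2) * n"] odd ring) (rule refl)
  qed
  with sums_mult[OF odd_sums[of "m + 2"], of "q ^ (2 * m + 2)"]
  have "(\<lambda>n. f (Suc n)) sums (q ^ (2 * m + 2) * odd_sum (m + 2))"
    by (simp only:)
  then have "f sums (q ^ (2 * m + 2) * odd_sum (m + 2) + f 0)"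
    by (simp only: sums_Suc_iff add_diff_cancel_right')
  moreover have "f 0 = 0" by (simp add: f_def)
  ultimately show ?thesis using f sums_unique2 by force
qed

text \<open>The weight (q^2)^(n(n+d)) equals q^(2n^2+2dn), so the d of a Bailey pair becomes the m
  of the sum.\<close>

lemma initial_sums:
  shows "odd_sum 1 = qpochs_inf [q, q ^ 6, q ^ 7] (q ^ 7) / qpoch_inf (q ^ 2) (q ^ 2)"
    and "even_sum 1 = qpochs_inf [q ^ 2, q ^ 5, q ^ 7] (q ^ 7) / qpoch_inf (q ^ 2) (q ^ 2)"
    and "even_sum 0 = qpochs_inf [q ^ 3, q ^ 4, q ^ 7] (q ^ 7) / qpoch_inf (q ^ 2) (q ^ 2)"
proof -
  obtain B where B: "\<And>n. norm (even_coeff n) \<le> B" "\<And>n. norm (odd_coeff n) \<le> B"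
    using coeff_bounded by blast
  have e: "(q ^ 2) ^ (n * (n + d)) = q ^ (2 * n ^ 2 + 2 * d * n)" for n d
  proof -
    have "2 * (n * (n + d)) = 2 * n ^ 2 + 2 * d * n"
      by (simp add: power2_eq_square algebra_simps)
    then show ?thesis by (simp only: power_mult[symmetric])
  qed
  have "(\<lambda>n. (q ^ 2) ^ (n * (n + 1)) * odd_coeff n) sums
    (qpoch_inf (q ^ 6) (q ^ 7) * qpoch_inf (q ^ 1) (q ^ 7) * qpoch_inf (q ^ 7) (q ^ 7) / qpoch_inf (q ^ 2) (q ^ 2))"
    by (rule rogers_selberg[OF q _ _ _ _ B(2), where k = 2])
      (use bailey_pair_odd[OF q] in \<open>simp_all add: odd_coeff_def\<close>)
  from sums_unique2[OF odd_sums this[unfolded e]]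
  show "odd_sum 1 = qpochs_inf [q, q ^ 6, q ^ 7] (q ^ 7) / qpoch_inf (q ^ 2) (q ^ 2)"
    by (simp add: qpochs_inf_def mult_ac)
  have "(\<lambda>n. (q ^ 2) ^ (n * (n + 1)) * even_coeff n) sums
    (qpoch_inf (q ^ 5) (q ^ 7) * qpoch_inf (q ^ 2) (q ^ 7) * qpoch_inf (q ^ 7) (q ^ 7) / qpoch_inf (q ^ 2) (q ^ 2))"
    by (rule rogers_selberg[OF q _ _ _ _ B(1), where k = 1])
      (use bailey_pair_odd_reflected[OF q] in \<open>simp_all add: even_coeff_def\<close>)
  from sums_unique2[OF even_sums this[unfolded e]]
  show "even_sum 1 = qpochs_inf [q ^ 2, q ^ 5, q ^ 7] (q ^ 7) / qpoch_inf (q ^ 2) (q ^ 2)"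
    by (simp add: qpochs_inf_def mult_ac)
  have "(\<lambda>n. (q ^ 2) ^ (n * (n + 0)) * even_coeff n) sums
    (qpoch_inf (q ^ 4) (q ^ 7) * qpoch_inf (q ^ 3) (q ^ 7) * qpoch_inf (q ^ 7) (q ^ 7) / qpoch_inf (q ^ 2) (q ^ 2))"
    by (rule rogers_selberg[OF q _ _ _ _ B(1), where k = 2])
      (use bailey_pair_even[OF q] in \<open>simp_all add: even_coeff_def\<close>)
  from sums_unique2[OF even_sums this[unfolded e]]
  show "even_sum 0 = qpochs_inf [q ^ 3, q ^ 4, q ^ 7] (q ^ 7) / qpoch_inf (q ^ 2) (q ^ 2)"
    by (simp add: qpochs_inf_def mult_ac)
qed

text \<open>Multiplying S(m+2) = T(m+2) + q T(m+3) by q^(2m+3) turns both terms on the right into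
  multiples of differences of S, which eliminates T.\<close>

lemma even_sum_rec:
  "even_sum (m + 3) = - (q + q ^ (2 * m + 3)) * even_sum (m + 2) + even_sum (m + 1) + q * even_sum m"
proof -
  have "even_sum (m + 1) - even_sum (m + 3) = q ^ (2 * m + 4) * odd_sum (m + 3)"
    using even_sum_diff[of "m + 1"] by (simp add: numeral_eq_Suc)
  moreover have "even_sum (m + 2) = odd_sum (m + 2) + q * odd_sum (m + 3)"
    using odd_sum_add[of "m + 2"] by (simp add: numeral_eq_Suc)
  then have "q ^ (2 * m + 3) * even_sum (m + 2) = q * (q ^ (2 * m + 2) * odd_sum (m + 2)) + q ^ (2 * m + 4) * odd_sum (m + 3)"
    by (simp add: algebra_simps numeral_eq_Suc)
  ultimately show ?thesis
    unfolding even_sum_diff[of m, symmetric] by (simp add: algebra_simps)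
qed

text \<open>Here S is eliminated. The recursion of A, B, C is that of q^m T(m) rather than of T(m),
  whence the factor q^(-m) in the final formula.\<close>

lemma odd_sum_rec:
  "q ^ (m + 3) * odd_sum (m + 3) = - (1 + q ^ (2 * m + 2)) * (q ^ (m + 2) * odd_sum (m + 2))
    + q ^ 2 * (q ^ (m + 1) * odd_sum (m + 1)) + q ^ 2 * (q ^ m * odd_sum m)"
proof -
  have "even_sum (m + 2) = odd_sum (m + 2) + q * odd_sum (m + 3)"
    using odd_sum_add[of "m + 2"] by (simp add: numeral_eq_Suc)
  then have "odd_sum m + q * odd_sum (m + 1) - (odd_sum (m + 2) + q * odd_sum (m + 3))
      = q ^ (2 * m + 2) * odd_sum (m + 2)"
    using even_sum_diff[of m] odd_sum_add[of m] by simp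
  then have "q ^ (m + 2) * (odd_sum m + q * odd_sum (m + 1) - (odd_sum (m + 2) + q * odd_sum (m + 3)))
      = q ^ (m + 2) * (q ^ (2 * m + 2) * odd_sum (m + 2))" by simp
  then show ?thesis
    by (simp add: algebra_simps power_add power2_eq_square power3_eq_cube)
qed

end

section \<open>Matching recursions and initial values\<close>

theorem theorem3p1:
  fixes q :: complex and A B C E F G :: "nat \<Rightarrow> complex"
  assumes q: "0 < norm q" "norm q < 1"
    and rec1: "\<And>X m. X \<in> {A, B, C} \<Longrightarrow> 3 \<le> m \<Longrightarrow>
      X m = - (1 + q ^ (2 * m - 4)) * X (m - 1) + q ^ 2 * X (m - 2) + q ^ 2 * X (m - 3)"
    and A_init: "A 0 = - q" "A 1 = q" "A 2 = - q"
    and B_init: "B 0 = 0" "B 1 = 0" "B 2 = q"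
    and C_init: "C 0 = 1" "C 1 = 0" "C 2 = 0"
    and rec2: "\<And>X m. X \<in> {E, F, G} \<Longrightarrow> 3 \<le> m \<Longrightarrow>
      X m = - (q + q ^ (2 * m - 3)) * X (m - 1) + X (m - 2) + q * X (m - 3)"
    and E_init: "E 0 = 0" "E 1 = 0" "E 2 = q"
    and F_init: "F 0 = 0" "F 1 = 1" "F 2 = - q"
    and G_init: "G 0 = 1" "G 1 = 0" "G 2 = 1"
  shows "(\<forall>m::nat.
      (\<lambda>n. q ^ (2 * n ^ 2 + 2 * m * n) / (qpoch (q ^ 2) (q ^ 2) n * qpoch (- q) q (2 * n + 1))) sums
        (q powi (- int m) * qpochs_inf [q, q ^ 6, q ^ 7] (q ^ 7) / qpoch_inf (q ^ 2) (q ^ 2) * A m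
       + q powi (- int m) * qpochs_inf [q ^ 2, q ^ 5, q ^ 7] (q ^ 7) / qpoch_inf (q ^ 2) (q ^ 2) * B m
       + q powi (- int m) * qpochs_inf [q ^ 3, q ^ 4, q ^ 7] (q ^ 7) / qpoch_inf (q ^ 2) (q ^ 2) * C m))
    \<and> (\<forall>m::nat.
      (\<lambda>n. q ^ (2 * n ^ 2 + 2 * m * n) / (qpoch (q ^ 2) (q ^ 2) n * qpoch (- q) q (2 * n))) sums
        (qpochs_inf [q, q ^ 6, q ^ 7] (q ^ 7) / qpoch_inf (q ^ 2) (q ^ 2) * E m
       + qpochs_inf [q ^ 2, q ^ 5, q ^ 7] (q ^ 7) / qpoch_inf (q ^ 2) (q ^ 2) * F m
       + qpochs_inf [q ^ 3, q ^ 4, q ^ 7] (q ^ 7) / qpoch_inf (q ^ 2) (q ^ 2) * G m))"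
proof -
  have q': "norm q < 1" "q \<noteq> 0" using q by auto
  let ?L = "qpoch_inf (q ^ 2) (q ^ 2)"
  define V1 where "V1 = qpochs_inf [q, q ^ 6, q ^ 7] (q ^ 7) / ?L"
  define V2 where "V2 = qpochs_inf [q ^ 2, q ^ 5, q ^ 7] (q ^ 7) / ?L"
  define V3 where "V3 = qpochs_inf [q ^ 3, q ^ 4, q ^ 7] (q ^ 7) / ?L"
  note V = initial_sums[OF q', folded V1_def V2_def V3_def]
  \<comment> \<open>T(0) = S(0) - q T(1) has the coordinates -q, 0, 1 prescribed for A, B, C at
    0.\<close>
  have odd0: "odd_sum q 0 = V3 - q * V1"
    using odd_sum_add[OF q', of 0] V by (simp add: algebra_simps)
  \<comment> \<open>q T(2) = S(1) - T(1); one more factor q gives the coordinates -q, q, 0 of q^2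
    T(2).\<close>
  have odd2: "q * odd_sum q 2 = V2 - V1"
    using odd_sum_add[OF q', of 1] V by (simp add: algebra_simps numeral_2_eq_2)
  \<comment> \<open>S(2) = S(0) - q^2 T(2) has the coordinates q, -q, 1 prescribed for E, F, G at
    2.\<close>
  have even2: "even_sum q 2 = V3 - q * (V2 - V1)"
    using even_sum_diff[OF q', of 0] V unfolding odd2[symmetric]
    by (simp add: algebra_simps power2_eq_square numeral_2_eq_2)
  \<comment> \<open>Starting the index at m + 3 removes the truncated subtractions.\<close>
  have rec1': "X (m + 3) = - (1 + q ^ (2 * m + 2)) * X (m + 2) + q ^ 2 * X (m + 1) + q ^ 2 * X m"
    if "X \<in> {A, B, C}" for X m
  proof -
    have "2 * (m + 3) - 4 = 2 * m + 2" "m + 3 - 1 = m + 2" "m + 3 - 2 = m + 1" "m + 3 - 3 = m"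
      by simp_all
    then show ?thesis using rec1[OF that, of "m + 3"] by (simp only: le_add2 simp_thms) 
  qed
  have rec2': "X (m + 3) = - (q + q ^ (2 * m + 3)) * X (m + 2) + X (m + 1) + q * X m"
    if "X \<in> {E, F, G}" for X m
  proof -
    have "2 * (m + 3) - 3 = 2 * m + 3" "m + 3 - 1 = m + 2" "m + 3 - 2 = m + 1" "m + 3 - 3 = m"
      by simp_all
    then show ?thesis using rec2[OF that, of "m + 3"] by (simp only: le_add2 simp_thms)
  qed
  have step3: "P m" if "P 0" "P 1" "P 2" "\<And>m. P m \<Longrightarrow> P (m + 1) \<Longrightarrow> P (m + 2) \<Longrightarrow> P (m + 3)"
    for P :: "nat \<Rightarrow> bool" and m
  proof -
    have "P m \<and> P (m + 1) \<and> P (m + 2)"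
      by (induction m) (use that in \<open>auto simp: numeral_eq_Suc\<close>)
    then show ?thesis by simp
  qed
  have odd: "q ^ m * odd_sum q m = V1 * A m + V2 * B m + V3 * C m" for m
  proof (rule step3[of "\<lambda>m. q ^ m * odd_sum q m = V1 * A m + V2 * B m + V3 * C m"])
    show "q ^ 0 * odd_sum q 0 = V1 * A 0 + V2 * B 0 + V3 * C 0"
      by (simp add: odd0 A_init B_init C_init)
    show "q ^ 1 * odd_sum q 1 = V1 * A 1 + V2 * B 1 + V3 * C 1"
      using V by (simp add: A_init B_init C_init del: One_nat_def)
    show "q ^ 2 * odd_sum q 2 = V1 * A 2 + V2 * B 2 + V3 * C 2"
      using odd2 by (simp add: A_init B_init C_init power2_eq_square mult.assoc) (simp add: algebra_simps)
  next
    fix m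
    assume IH: "q ^ m * odd_sum q m = V1 * A m + V2 * B m + V3 * C m"
      "q ^ (m + 1) * odd_sum q (m + 1) = V1 * A (m + 1) + V2 * B (m + 1) + V3 * C (m + 1)"
      "q ^ (m + 2) * odd_sum q (m + 2) = V1 * A (m + 2) + V2 * B (m + 2) + V3 * C (m + 2)"
    have r: "A (m + 3) = - (1 + q ^ (2 * m + 2)) * A (m + 2) + q ^ 2 * A (m + 1) + q ^ 2 * A m"
      "B (m + 3) = - (1 + q ^ (2 * m + 2)) * B (m + 2) + q ^ 2 * B (m + 1) + q ^ 2 * B m"
      "C (m + 3) = - (1 + q ^ (2 * m + 2)) * C (m + 2) + q ^ 2 * C (m + 1) + q ^ 2 * C m"
      by (rule rec1'; simp)+
    show "q ^ (m + 3) * odd_sum q (m + 3) = V1 * A (m + 3) + V2 * B (m + 3) + V3 * C (m + 3)"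
      unfolding odd_sum_rec[OF q'] IH r by algebra
  qed
  have even: "even_sum q m = V1 * E m + V2 * F m + V3 * G m" for m
  proof (rule step3[of "\<lambda>m. even_sum q m = V1 * E m + V2 * F m + V3 * G m"])
    show "even_sum q 0 = V1 * E 0 + V2 * F 0 + V3 * G 0"
      using V by (simp add: E_init F_init G_init)
    show "even_sum q 1 = V1 * E 1 + V2 * F 1 + V3 * G 1"
      using V by (simp add: E_init F_init G_init del: One_nat_def)
    show "even_sum q 2 = V1 * E 2 + V2 * F 2 + V3 * G 2"
      by (simp add: even2 E_init F_init G_init algebra_simps)
  next
    fix m
    assume IH: "even_sum q m = V1 * E m + V2 * F m + V3 * G m"
      "even_sum q (m + 1) = V1 * E (m + 1) + V2 * F (m + 1) + V3 * G (m + 1)"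
      "even_sum q (m + 2) = V1 * E (m + 2) + V2 * F (m + 2) + V3 * G (m + 2)"
    have r: "E (m + 3) = - (q + q ^ (2 * m + 3)) * E (m + 2) + E (m + 1) + q * E m"
      "F (m + 3) = - (q + q ^ (2 * m + 3)) * F (m + 2) + F (m + 1) + q * F m"
      "G (m + 3) = - (q + q ^ (2 * m + 3)) * G (m + 2) + G (m + 1) + q * G m"
      by (rule rec2'; simp)+
    show "even_sum q (m + 3) = V1 * E (m + 3) + V2 * F (m + 3) + V3 * G (m + 3)"
      unfolding even_sum_rec[OF q'] IH r by algebra
  qed
  have "odd_sum q m = q powi (- int m) * qpochs_inf [q, q ^ 6, q ^ 7] (q ^ 7) / ?L * A m
       + q powi (- int m) * qpochs_inf [q ^ 2, q ^ 5, q ^ 7] (q ^ 7) / ?L * B m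
       + q powi (- int m) * qpochs_inf [q ^ 3, q ^ 4, q ^ 7] (q ^ 7) / ?L * C m" for m
  proof -
    have "odd_sum q m = q powi (- int m) * (q ^ m * odd_sum q m)"
      using q'(2) by (simp add: power_int_minus)
    then show ?thesis unfolding odd V1_def V2_def V3_def by (simp add: distrib_left mult.assoc)
  qed
  then show ?thesis
    using odd_sums[OF q'] even_sums[OF q'] even
    unfolding odd_coeff_def[OF q'] even_coeff_def[OF q'] V1_def V2_def V3_def by simp
qed

end
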